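(* There is an absolute constant $C>0$ such that the following holds for all $p>2$ and all integers $n\ge 2$. Let $\Phi$ be a $\nu$-self-concordant barrier on the unit ball $\{x\in\mathbb{R}^n:\|x\|_p\le 1\}$ of $\ell_p^n$, and assume that $\Phi$ is symmetric in the sense that $$\Phi(x_1,\ldots,x_n)=\Phi(|x_1|,\ldots,|x_n|)$$ for all $x$ in the interior of the ball. Then $$\nu\geq\frac{n}{(C\,p\log n)^{\frac{p}{p-2}}}.$$
   Context: Let $\mathcal{K}\subset\mathbb{R}^n$ be a convex body. A function $\Phi:\mathrm{int}(\mathcal{K})\to\mathbb{R}$ is a barrier for $\mathcal{K}$ if $\Phi(x)\to+\infty$ as $x\to\partial\mathcal{K}$. A $C^3$-smooth convex function $\Phi:\mathrm{int}(\mathcal{K})\to\mathbb{R}$ is self-concordant if for all $x\in\mathrm{int}(\mathcal{K})$, $h\in\mathbb{R}^n$: $\nabla^3\Phi(x)[h,h,h]\le 2(\nabla^2\Phi(x)[h,h])^{3/2}$. It is $\nu$-self-concordant if in addition $\nabla\Phi(x)[h]\le\sqrt{\nu\cdot\nabla^2\Phi(x)[h,h]}$ for all $x\in\mathrm{int}(\mathcal{K})$, $h\in\mathbb{R}^n$. *)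

theory Defs
  imports "HOL-Analysis.Analysis"
begin

text \<open>
  The dimension has to be a natural number quantified inside the statement (the constant must not
  depend on it), so \<open>\<real>\<^sup>n\<close> is the library space \<^const>\<open>Euclidean_space\<close> \<open>n\<close>: sequences
  \<open>x :: nat \<Rightarrow> real\<close> with \<open>x i = 0\<close> for all \<open>i \<ge> n\<close>, with the product topology. A function defined on
  the interior of \<open>K\<close> is a total function of which only the values on that interior are used.
\<close>

abbreviation interior_Rn :: "nat \<Rightarrow> (nat \<Rightarrow> real) set \<Rightarrow> (nat \<Rightarrow> real) set" where
  "interior_Rn n K \<equiv> Euclidean_space n interior_of K"

abbreviation boundary_Rn :: "nat \<Rightarrow> (nat \<Rightarrow> real) set \<Rightarrow> (nat \<Rightarrow> real) set" where
  "boundary_Rn n K \<equiv> Euclidean_space n frontier_of K"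

definition partial_deriv :: "nat \<Rightarrow> ((nat \<Rightarrow> real) \<Rightarrow> real) \<Rightarrow> (nat \<Rightarrow> real) \<Rightarrow> real" where
  "partial_deriv i f x = deriv (\<lambda>t. f (x(i := t))) (x i)"

primrec smooth_Rn :: "nat \<Rightarrow> nat \<Rightarrow> (nat \<Rightarrow> real) set \<Rightarrow> ((nat \<Rightarrow> real) \<Rightarrow> real) \<Rightarrow> bool" where
  "smooth_Rn n 0 S f \<longleftrightarrow>
     continuous_map (subtopology (Euclidean_space n) S) euclideanreal f"
| "smooth_Rn n (Suc k) S f \<longleftrightarrow>
     continuous_map (subtopology (Euclidean_space n) S) euclideanreal f \<and>
     (\<forall>i<n. (\<forall>x\<in>S. (\<lambda>t. f (x(i := t))) field_differentiable (at (x i))) \<and>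
            smooth_Rn n k S (partial_deriv i f))"

definition D1 :: "nat \<Rightarrow> ((nat \<Rightarrow> real) \<Rightarrow> real) \<Rightarrow> (nat \<Rightarrow> real) \<Rightarrow> (nat \<Rightarrow> real) \<Rightarrow> real" where
  "D1 n f x u = (\<Sum>i<n. partial_deriv i f x * u i)"

definition D2 :: "nat \<Rightarrow> ((nat \<Rightarrow> real) \<Rightarrow> real) \<Rightarrow> (nat \<Rightarrow> real) \<Rightarrow>
    (nat \<Rightarrow> real) \<Rightarrow> (nat \<Rightarrow> real) \<Rightarrow> real" where
  "D2 n f x u v = (\<Sum>i<n. \<Sum>j<n. partial_deriv i (partial_deriv j f) x * u i * v j)"

definition D3 :: "nat \<Rightarrow> ((nat \<Rightarrow> real) \<Rightarrow> real) \<Rightarrow> (nat \<Rightarrow> real) \<Rightarrow>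
    (nat \<Rightarrow> real) \<Rightarrow> (nat \<Rightarrow> real) \<Rightarrow> (nat \<Rightarrow> real) \<Rightarrow> real" where
  "D3 n f x u v w = (\<Sum>i<n. \<Sum>j<n. \<Sum>k<n.
     partial_deriv i (partial_deriv j (partial_deriv k f)) x * u i * v j * w k)"

text \<open>The library's \<^const>\<open>convex_on\<close> needs a \<^class>\<open>real_vector\<close> type, which \<open>nat \<Rightarrow> real\<close> is not.\<close>

definition convex_fun_on :: "(nat \<Rightarrow> real) set \<Rightarrow> ((nat \<Rightarrow> real) \<Rightarrow> real) \<Rightarrow> bool" where
  "convex_fun_on S f \<longleftrightarrow>
     (\<forall>x\<in>S. \<forall>y\<in>S. \<forall>u\<ge>0. \<forall>v\<ge>0. u + v = 1 \<longrightarrow>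
        (\<lambda>i. u * x i + v * y i) \<in> S \<and> f (\<lambda>i. u * x i + v * y i) \<le> u * f x + v * f y)"

definition barrier :: "nat \<Rightarrow> (nat \<Rightarrow> real) set \<Rightarrow> ((nat \<Rightarrow> real) \<Rightarrow> real) \<Rightarrow> bool" where
  "barrier n K \<Phi> \<longleftrightarrow>
     (\<forall>z \<in> boundary_Rn n K.
        filterlim \<Phi> at_top (atin_within (Euclidean_space n) z (interior_Rn n K)))"

definition self_concordant :: "nat \<Rightarrow> (nat \<Rightarrow> real) set \<Rightarrow> ((nat \<Rightarrow> real) \<Rightarrow> real) \<Rightarrow> bool" where
  "self_concordant n K \<Phi> \<longleftrightarrow>
     smooth_Rn n 3 (interior_Rn n K) \<Phi> \<and>
     convex_fun_on (interior_Rn n K) \<Phi> \<and>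
     (\<forall>x \<in> interior_Rn n K. \<forall>h \<in> topspace (Euclidean_space n).
        D3 n \<Phi> x h h h \<le> 2 * D2 n \<Phi> x h h powr (3/2))"

text \<open>
  The conjunct \<open>0 \<le> \<nu>\<close> makes the square root below a genuine one: \<^const>\<open>sqrt\<close> is total and odd.
\<close>

definition nu_self_concordant ::
    "real \<Rightarrow> nat \<Rightarrow> (nat \<Rightarrow> real) set \<Rightarrow> ((nat \<Rightarrow> real) \<Rightarrow> real) \<Rightarrow> bool" where
  "nu_self_concordant \<nu> n K \<Phi> \<longleftrightarrow>
     0 \<le> \<nu> \<and> self_concordant n K \<Phi> \<and>
     (\<forall>x \<in> interior_Rn n K. \<forall>h \<in> topspace (Euclidean_space n).
        D1 n \<Phi> x h \<le> sqrt (\<nu> * D2 n \<Phi> x h h))"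

definition lp_norm :: "real \<Rightarrow> nat \<Rightarrow> (nat \<Rightarrow> real) \<Rightarrow> real" where
  "lp_norm p n x = (\<Sum>i<n. \<bar>x i\<bar> powr p) powr (1 / p)"

definition lp_ball :: "real \<Rightarrow> nat \<Rightarrow> (nat \<Rightarrow> real) set" where
  "lp_ball p n = {x \<in> topspace (Euclidean_space n). lp_norm p n x \<le> 1}"

end

theory Submission
  imports Defs
begin

text \<open>
  Let \<open>U\<close> be the open unit ball and call \<open>\<delta>(x) = 1 - \<Sum>\<bar>x\<^sub>i\<bar>\<^sup>p\<close> the slack of \<open>x\<close>. Two estimates for the price,
  in units of \<open>\<Phi>\<close>, of lowering coordinates pull against each other.

  \<^item> On an axis parallel line \<open>\<phi>(t) = \<Phi>(x(i := t))\<close> is even and convex, and self-concordance says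
    that \<open>\<phi>''\<^bsup>-1/2\<^esup>\<close> is 1-Lipschitz. If \<open>\<phi>\<close> rises by 1 between \<open>0\<close> and \<open>v\<close>, or if the line leaves the
    ball before \<open>v\<close> (there \<open>\<phi>\<close> blows up), then \<open>\<phi>'' \<ge> 1/(4v\<^sup>2)\<close> on the whole part of \<open>[0, v]\<close> inside
    the ball. Hence lowering one coordinate from \<open>b \<le> v\<close> to \<open>(1 - \<eta>) b\<close> with \<open>\<eta> \<le> 1/2\<close> lowers \<open>\<Phi>\<close>
    by at least a constant times \<open>\<eta> (b/v)\<^sup>2\<close>.
  \<^item> If \<open>x + h \<in> U\<close>, then \<open>\<nabla>\<Phi>(x)[h] \<le> \<nu>\<close>. Hence moving from \<open>x\<close> to \<open>x - \<eta> h\<close> lowers \<open>\<Phi>\<close> by at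
    most \<open>\<eta> \<nu>\<close>.

  Consider a point \<open>x\<close> at least half of whose coordinates have a common value \<open>b\<close> with
  \<open>n b\<^sup>p = 4\<^bsup>-p\<^esup> \<delta>(x)\<close>, and let \<open>h\<close> be \<open>b\<close> on these coordinates and \<open>0\<close> elsewhere. Choose \<open>\<eta>\<close> such that
  \<open>\<Phi>(x) - \<Phi>(x - \<eta> h) = 2\<close>. The second estimate gives \<open>2 \<le> \<eta> \<nu>\<close>. If the first one is available with
  \<open>v\<^sup>p\<close> of the order of \<open>b\<^sup>p + p \<eta> \<delta>\<close>, adding it up over the lowered coordinates gives
  \<open>2 \<ge> c n \<eta> (b/v)\<^sup>2\<close>, where \<open>(v/b)\<^sup>p\<close> is at most \<open>C\<^sup>p (1 + n \<eta>)\<close>. If \<open>n \<eta> \<ge> 1\<close>,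
  this yields \<open>(n \<eta>)\<^bsup>1-2/p\<^esup> \<le> C\<close>, with constants \<open>c, C > 0\<close> that may differ from line
  to line. Then \<open>\<nu> \<ge> 2/\<eta> \<ge> n / C\<^bsup>p/(p-2)\<^esup>\<close>. As \<open>p log n \<ge> 1\<close>, this implies the theorem.

  The rise along the axis comes from the choice of \<open>x\<close>: it nearly minimizes \<open>\<Phi>\<close> among the points all
  of whose coordinates are at least the floor \<open>b\<close>, the floor being tied to the slack as above, and at
  most \<open>k\<close> of whose coordinates differ from \<open>b\<close> (\<open>floor_config\<close>). Raise one floor coordinate of
  \<open>x - \<eta> h\<close> to the value \<open>v\<close> for which the slack becomes \<open>(1 - \<eta>)\<^sup>p \<delta>(x)\<close>. The resulting point \<open>m\<close> is
  of the same kind, with floor \<open>(1 - \<eta>) b\<close> and \<open>k + 1\<close> in place of \<open>k\<close>. The number \<open>k < n/2\<close> is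
  chosen by the pigeonhole principle such that allowing one more exceptional coordinate hardly lowers
  the infimum (\<open>almost_minimizer\<close>), so \<open>\<Phi>(m) \<ge> \<Phi>(x) - 1/4\<close>. Now \<open>m\<close> is the midpoint of the point \<open>q\<close> that
  arises from \<open>x\<close>, or from \<open>x\<close> with some other floor coordinates already lowered to \<open>(1 - \<eta>) b\<close>, by
  raising the same coordinate to \<open>2v\<close>, and of a point \<open>w\<close> below \<open>x - \<eta> h\<close>. Since
  \<open>\<Phi>(w) \<le> \<Phi>(x) - 2\<close>, convexity forces \<open>\<Phi>(q) \<ge> 2 \<Phi>(m) - \<Phi>(w) \<ge> \<Phi>(x) + 1\<close> (\<open>unit_drop_bound\<close>).

  No suitable \<open>\<eta> \<le> 1/2\<close> need exist if even halving the floor coordinates lowers \<open>\<Phi>\<close> by less than 2. In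
  that case the blow-up at the boundary alone bounds the curvature from below, and \<open>n\<close> is at most
  \<open>C\<^bsup>p/(p-2)\<^esup>\<close> (\<open>half_drop_small_imp\<close>), so that a constant lower bound for \<open>\<nu>\<close> suffices.
\<close>

section \<open>Derivatives along lines in \<open>\<real>\<^sup>n\<close>\<close>

lemma continuous_map_Euclidean_subtopology_iff:
  assumes "S \<subseteq> topspace (Euclidean_space n)"
  shows "continuous_map (subtopology (Euclidean_space n) S) euclideanreal f \<longleftrightarrow> continuous_on S f"
proof -
  have "subtopology (Euclidean_space n) S = top_of_set S"
    using assms
    by (simp add: Euclidean_space_def euclidean_product_topology subtopology_subtopology
        topspace_Euclidean_space Int_absorb1)
  then show ?thesis by simp
qed

lemma openin_Euclidean_space_open:
  "openin (Euclidean_space n) S \<longleftrightarrow> (\<exists>T. open T \<and> S = T \<inter> topspace (Euclidean_space n))"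
  by (simp add: Euclidean_space_def openin_subtopology euclidean_product_topology
      topspace_Euclidean_space)

lemma partial_deriv_has_field_derivative:
  assumes "smooth_Rn n (Suc k) S f" "x(i := t) \<in> S" "i < n"
  shows "((\<lambda>s. f (x(i := s))) has_real_derivative partial_deriv i f (x(i := t))) (at t)"
proof -
  have "(\<lambda>s. f ((x(i := t))(i := s))) field_differentiable (at ((x(i := t)) i))"
    using assms unfolding smooth_Rn.simps by blast
  then have "(\<lambda>s. f (x(i := s))) field_differentiable (at t)" by simp
  then show ?thesis
    unfolding partial_deriv_def by (simp add: DERIV_deriv_iff_field_differentiable)
qed

text \<open>
  The chain rule along a line needs a total derivative, which exists because the partial
  derivatives are continuous; the coordinates are switched on one at a time.
\<close>

lemma has_real_derivative_line_aux:
  assumes smooth: "smooth_Rn n (Suc 0) S f" and op: "openin (Euclidean_space n) S" and x: "x \<in> S"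
    and "k \<le> n"
  shows "((\<lambda>t. f (\<lambda>i. if i < k then x i + t * h i else x i)) has_real_derivative
          (\<Sum>i<k. partial_deriv i f x * h i)) (at 0)"
  using \<open>k \<le> n\<close>
proof (induction k)
  case 0
  then show ?case by simp
next
  case (Suc k)
  then have "k < n" by simp
  have SE: "S \<subseteq> topspace (Euclidean_space n)" using op openin_subset by blast
  obtain T where T: "open T" "S = T \<inter> topspace (Euclidean_space n)"
    using op by (auto simp: openin_Euclidean_space_open)
  define P where "P = (\<lambda>t::real. \<lambda>i. if i < k then x i + t * h i else x i)"
  define Q where "Q = (\<lambda>q::real \<times> real. (P (fst q))(k := x k + snd q * h k))"
  have contQ: "continuous_on UNIV Q"
    unfolding Q_def P_def fun_upd_def
  proof (intro continuous_on_coordinatewise_then_product)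
    fix i
    show "continuous_on UNIV (\<lambda>q::real \<times> real. if i = k then x k + snd q * h k
            else if i < k then x i + fst q * h i else x i)"
      by (cases "i = k"; cases "i < k") (auto intro!: continuous_intros)
  qed
  have Q0: "Q (0,0) = x" by (auto simp: Q_def P_def)
  have QE: "Q q \<in> topspace (Euclidean_space n)" for q
    using x SE \<open>k < n\<close> by (auto simp: Q_def P_def topspace_Euclidean_space subset_iff)
  have "open (Q -` T)" using contQ T(1) by (simp add: open_vimage)
  moreover have "(0,0) \<in> Q -` T" using Q0 x T by simp
  ultimately obtain X Y where XY: "open X" "open Y" "(0,0) \<in> X \<times> Y" "X \<times> Y \<subseteq> Q -` T"
    by (rule open_prod_elim)
  obtain e where e: "e > 0" "ball 0 e \<subseteq> Y" using XY openE[of Y 0] by auto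
  define B where "B = ball (0::real) e"
  have QS: "Q (t,s) \<in> S" if "t \<in> X" "s \<in> B" for t s
  proof -
    have "(t,s) \<in> X \<times> Y" using that e by (auto simp: B_def)
    then show ?thesis using XY QE[of "(t,s)"] T by blast
  qed
  have f1: "((\<lambda>t. f (Q (t,0))) has_derivative (*) (\<Sum>i<k. partial_deriv i f x * h i)) (at 0 within X)"
  proof -
    have "Q (t,0) = (\<lambda>i. if i < k then x i + t * h i else x i)" for t
      by (auto simp: Q_def P_def)
    then show ?thesis
      using Suc by (simp add: has_field_derivative_def has_derivative_at_withinI)
  qed
  have f2: "((\<lambda>s. f (Q (t,s))) has_derivative
      blinfun_apply (blinfun_mult_right (partial_deriv k f (Q (t,s)) * h k))) (at s within B)"
    if "t \<in> X" "s \<in> B" for t s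
  proof -
    have "((\<lambda>u. f ((P t)(k := u))) has_real_derivative
        partial_deriv k f ((P t)(k := x k + s * h k))) (at (x k + s * h k))"
      using QS[OF that] \<open>k < n\<close>
      by (intro partial_deriv_has_field_derivative[OF smooth]) (simp_all add: Q_def)
    moreover have "((\<lambda>s. x k + s * h k) has_real_derivative h k) (at s)"
      by (auto intro!: derivative_eq_intros)
    ultimately have "((\<lambda>s'. f ((P t)(k := x k + s' * h k))) has_real_derivative
        partial_deriv k f ((P t)(k := x k + s * h k)) * h k) (at s)"
      by (rule DERIV_chain2)
    then have "((\<lambda>s. f (Q (t,s))) has_derivative
        blinfun_apply (blinfun_mult_right (partial_deriv k f (Q (t,s)) * h k))) (at s)"
      by (simp add: Q_def has_field_derivative_def)
    then show ?thesis by (rule has_derivative_at_withinI)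
  qed
  have cont: "continuous (at (0,0) within X \<times> B)
      (\<lambda>(t,s). blinfun_mult_right (partial_deriv k f (Q (t,s)) * h k))"
  proof -
    have "continuous_on S (partial_deriv k f)"
      using smooth \<open>k < n\<close> SE by (auto simp: continuous_map_Euclidean_subtopology_iff)
    then have "continuous_on (X \<times> B) (\<lambda>q. partial_deriv k f (Q q))"
      using QS by (intro continuous_on_compose2[OF _ continuous_on_subset[OF contQ]]) auto
    then have "continuous_on (X \<times> B) (\<lambda>q. blinfun_mult_right (partial_deriv k f (Q q) * h k))"
      by (intro bounded_linear.continuous_on[OF bounded_linear_blinfun_mult_right] continuous_intros)
    then show ?thesis
      using XY e by (auto simp: continuous_on_eq_continuous_within B_def split_beta')
  qed
  have "((\<lambda>(t,s). f (Q (t,s))) has_derivative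
      (\<lambda>(t,s). (\<Sum>i<k. partial_deriv i f x * h i) * t
        + blinfun_mult_right (partial_deriv k f (Q (0,0)) * h k) s)) (at (0,0) within X \<times> B)"
    using e by (intro has_derivative_partialsI f1 f2 cont) (auto simp: B_def)
  then have D: "((\<lambda>q. f (Q q)) has_derivative
      (\<lambda>q. (\<Sum>i<k. partial_deriv i f x * h i) * fst q + partial_deriv k f x * h k * snd q)) (at (0,0))"
    using XY e by (subst (asm) at_within_open)
      (auto simp: open_Times B_def Q0 split_beta' blinfun_mult_right.rep_eq)
  have "((\<lambda>t::real. (t,t)) has_derivative (\<lambda>t. (t,t))) (at 0)"
    by (auto intro!: derivative_eq_intros)
  from has_derivative_compose[OF this] D
  have "((\<lambda>t. f (Q (t,t))) has_derivative
      (\<lambda>t. (\<Sum>i<k. partial_deriv i f x * h i) * t + partial_deriv k f x * h k * t)) (at 0)"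
    by fastforce
  moreover have "Q (t,t) = (\<lambda>i. if i < Suc k then x i + t * h i else x i)" for t
    by (auto simp: Q_def P_def)
  ultimately show ?case
    by (simp add: has_field_derivative_def distrib_right[symmetric])
qed

lemma has_real_derivative_line:
  assumes smooth: "smooth_Rn n (Suc k) S f" and op: "openin (Euclidean_space n) S"
    and x: "(\<lambda>i. x i + t * h i) \<in> S" and h: "h \<in> topspace (Euclidean_space n)"
  shows "((\<lambda>t. f (\<lambda>i. x i + t * h i)) has_real_derivative
          (\<Sum>i<n. partial_deriv i f (\<lambda>i. x i + t * h i) * h i)) (at t)"
proof -
  have "smooth_Rn n 0 S g" if "smooth_Rn n k S g" for g
    using that by (cases k) auto
  then have "smooth_Rn n (Suc 0) S f" using smooth by auto
  from has_real_derivative_line_aux[OF this op x order_refl, of h]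
  have *: "((\<lambda>u. f (\<lambda>i. if i < n then x i + t * h i + u * h i else x i + t * h i)) has_real_derivative
    (\<Sum>i<n. partial_deriv i f (\<lambda>i. x i + t * h i) * h i)) (at 0)" .
  have "(\<lambda>i. if i < n then x i + t * h i + u * h i else x i + t * h i)
     = (\<lambda>i. x i + (t + u) * h i)" for u
    using h by (auto simp: topspace_Euclidean_space algebra_simps)
  with * show ?thesis
    using DERIV_shift[of "\<lambda>t. f (\<lambda>i. x i + t * h i)" _ 0 t] by (simp add: add.commute)
qed

section \<open>Self-concordant functions of one variable\<close>

text \<open>
  Self-concordance bounds the derivative of \<open>g\<^bsup>-1/2\<^esup>\<close> by 1, so a second derivative \<open>g\<close> that is small
  at \<open>s\<close> stays small near \<open>s\<close>. Points with \<open>g = 0\<close> are included by working with \<open>g + \<epsilon>\<close>; the choice of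
  \<open>\<epsilon>\<close> below makes \<open>(g s + \<epsilon>)\<^bsup>-1/2\<^esup>\<close> equal to \<open>2v\<close>.
\<close>

lemma sc_second_derivative_spread:
  fixes g g' :: "real \<Rightarrow> real"
  assumes der: "\<And>t. t \<in> I \<Longrightarrow> (g has_real_derivative g' t) (at t)"
    and sc: "\<And>t. t \<in> I \<Longrightarrow> \<bar>g' t\<bar> \<le> 2 * g t powr (3/2)"
    and nonneg: "\<And>t. t \<in> I \<Longrightarrow> 0 \<le> g t"
    and "{min s t..max s t} \<subseteq> I"
    and "v > 0" "\<bar>t - s\<bar> \<le> v" "g s < 1 / (4 * v\<^sup>2)"
  shows "g t \<le> 1 / v\<^sup>2"
proof -
  have sI: "s \<in> I" and tI: "t \<in> I" using assms(4) by auto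
  define \<epsilon> where "\<epsilon> = 1 / (4 * v\<^sup>2) - g s"
  have "\<epsilon> > 0" using assms by (simp add: \<epsilon>_def)
  define u where "u = (\<lambda>t. (g t + \<epsilon>) powr (-1/2))"
  define u' where "u' = (\<lambda>t. - (1/2) * (g t + \<epsilon>) powr (-3/2) * g' t)"
  have du: "(u has_real_derivative u' r) (at r)" if "r \<in> I" for r
    unfolding u_def u'_def using nonneg[OF that] \<open>\<epsilon> > 0\<close>
    by (auto intro!: derivative_eq_intros der[OF that] simp: field_simps)
  have bu: "\<bar>u' r\<bar> \<le> 1" if "r \<in> I" for r
  proof -
    have "\<bar>g' r\<bar> \<le> 2 * (g r + \<epsilon>) powr (3/2)"
      using sc[OF that] nonneg[OF that] \<open>\<epsilon> > 0\<close> powr_mono2[of "3/2" "g r" "g r + \<epsilon>"] by auto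
    then have "\<bar>u' r\<bar> \<le> 1/2 * (g r + \<epsilon>) powr (-3/2) * (2 * (g r + \<epsilon>) powr (3/2))"
      unfolding u'_def abs_mult by (intro mult_mono) auto
    also have "\<dots> = (g r + \<epsilon>) powr (-3/2 + 3/2)"
      by (simp only: powr_add)
    also have "\<dots> = 1" using nonneg[OF that] \<open>\<epsilon> > 0\<close> by simp
    finally show ?thesis .
  qed
  have lip: "\<bar>u t - u s\<bar> \<le> 1 * \<bar>t - s\<bar>"
  proof -
    have "norm (u t - u s) \<le> 1 * norm (t - s)"
      by (rule field_differentiable_bound[where S = "{min s t..max s t}" and f' = u'])
        (use assms(4) bu du in \<open>auto intro!: has_field_derivative_at_within du subsetD[OF assms(4)]\<close>)
    then show ?thesis by simp
  qed
  have us: "u s = 2 * v"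
  proof -
    have "g s + \<epsilon> = (2 * v) powr (-2)"
      using \<open>v > 0\<close> by (simp add: \<epsilon>_def powr_minus powr_numeral divide_simps power2_eq_square)
    then have "u s = (2 * v) powr (-2 * (-1/2))" unfolding u_def by (simp only: powr_powr)
    then show ?thesis using \<open>v > 0\<close> by simp
  qed
  have "v \<le> u t" using lip us assms by auto
  then have "u t powr (-2) \<le> v powr (-2)"
    using \<open>v > 0\<close> by (intro powr_mono2') auto
  moreover have "u t powr (-2) = g t + \<epsilon>"
    unfolding u_def powr_powr using nonneg[OF tI] \<open>\<epsilon> > 0\<close> by simp
  moreover have "v powr (-2) = 1 / v\<^sup>2"
    using \<open>v > 0\<close> by (simp add: powr_minus powr_numeral divide_simps)
  ultimately show ?thesis using \<open>\<epsilon> > 0\<close> by linarith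
qed

text \<open>
  Were the second derivative below \<open>1/(4v\<^sup>2)\<close> at \<open>s\<close>, it would be at most \<open>1/v\<^sup>2\<close> on \<open>[0, t]\<close>, and from
  the critical point 0 the function could not rise by 1 within distance \<open>t \<le> v\<close>.
\<close>

lemma sc_curvature_bound:
  fixes \<phi> \<phi>1 \<phi>2 \<phi>3 :: "real \<Rightarrow> real"
  assumes d1: "\<And>t. t \<in> I \<Longrightarrow> (\<phi> has_real_derivative \<phi>1 t) (at t)"
    and d2: "\<And>t. t \<in> I \<Longrightarrow> (\<phi>1 has_real_derivative \<phi>2 t) (at t)"
    and d3: "\<And>t. t \<in> I \<Longrightarrow> (\<phi>2 has_real_derivative \<phi>3 t) (at t)"
    and sc: "\<And>t. t \<in> I \<Longrightarrow> \<bar>\<phi>3 t\<bar> \<le> 2 * \<phi>2 t powr (3/2)"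
    and nonneg: "\<And>t. t \<in> I \<Longrightarrow> 0 \<le> \<phi>2 t"
    and crit: "\<phi>1 0 = 0"
    and I: "{0..max t s} \<subseteq> I" and ts: "0 \<le> t" "t \<le> v" "0 \<le> s" "s \<le> v" "0 < v"
    and rise: "\<phi> t \<ge> \<phi> 0 + 1"
  shows "\<phi>2 s \<ge> 1 / (4 * v\<^sup>2)"
proof (rule ccontr)
  assume "\<not> ?thesis"
  then have small: "\<phi>2 s < 1 / (4 * v\<^sup>2)" by simp
  have flat: "\<phi>2 r \<le> 1 / v\<^sup>2" if "0 \<le> r" "r \<le> t" for r
    by (rule sc_second_derivative_spread[OF d3 sc nonneg _ \<open>0 < v\<close> _ small])
      (use that ts I in \<open>auto intro!: subsetD[OF I]\<close>)
  have "t > 0" using rise ts by (cases "t = 0") auto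
  then obtain r where r: "0 < r" "r < t" "\<phi> t - \<phi> 0 = (t - 0) * \<phi>1 r"
    using MVT2[of 0 t \<phi> \<phi>1] d1 I by fastforce
  then obtain q where q: "0 < q" "q < r" "\<phi>1 r - \<phi>1 0 = (r - 0) * \<phi>2 q"
    using MVT2[of 0 r \<phi>1 \<phi>2] d2 I by fastforce
  have "\<phi> t - \<phi> 0 = t * r * \<phi>2 q" using q r crit by simp
  also have "\<dots> \<le> t * r * (1 / v\<^sup>2)"
    using q r ts flat[of q] by (intro mult_left_mono) auto
  also have "\<dots> < v * v * (1 / v\<^sup>2)"
  proof -
    have "t * r < v * v" using r ts by (intro mult_le_less_imp_less) auto
    then show ?thesis using ts by (intro mult_strict_right_mono) auto
  qed
  also have "\<dots> = 1" using ts by (simp add: power2_eq_square)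
  finally show False using rise by simp
qed

section \<open>Elementary estimates for powers\<close>

lemma one_minus_powr_le:
  fixes \<eta> p :: real
  assumes "0 \<le> \<eta>" "\<eta> \<le> 1/2" "0 \<le> p"
  shows "1 - (1 - \<eta>) powr p \<le> 2 * p * \<eta>"
proof -
  have "2 * \<eta>\<^sup>2 \<le> \<eta>" using mult_right_mono[of "2 * \<eta>" 1 \<eta>] assms by (simp add: power2_eq_square)
  then have "- 2 * \<eta> \<le> ln (1 - \<eta>)"
    using ln_one_minus_pos_lower_bound[of \<eta>] assms by linarith
  then have "p * (- 2 * \<eta>) \<le> p * ln (1 - \<eta>)" using assms by (intro mult_left_mono)
  moreover have "1 + p * ln (1 - \<eta>) \<le> (1 - \<eta>) powr p"
    using assms exp_ge_add_one_self[of "p * ln (1 - \<eta>)"] by (simp add: powr_def)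
  ultimately show ?thesis by (simp add: algebra_simps)
qed

lemma one_plus_le_two_powr:
  fixes p :: real
  assumes "1 \<le> p" shows "1 + p \<le> 2 powr p"
proof -
  have "1 + (p - 1) * ln 2 \<le> exp ((p - 1) * ln 2)" by (rule exp_ge_add_one_self)
  moreover have "(p - 1) * (1/2) \<le> (p - 1) * ln 2"
    using assms ln2_ge_two_thirds by (intro mult_left_mono) auto
  moreover have "2 powr p = 2 * exp ((p - 1) * ln 2)"
    using powr_add[of 2 1 "p - 1"] by (simp add: powr_def)
  ultimately show ?thesis by (simp add: field_simps)
qed

text \<open>
  Solves the self-referential estimates at the end of both main cases for \<open>X\<close>; this is where the
  exponent \<open>p/(p - 2)\<close> comes from.
\<close>

lemma powr_self_bound:
  fixes X A p :: real
  assumes "0 < X" "0 < A" "2 < p" "X \<le> A * X powr (2 / p)"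
  shows "X \<le> A powr (p / (p - 2))"
proof -
  have "X powr (1 - 2 / p) * X powr (2 / p) \<le> A * X powr (2 / p)"
    using assms by (simp add: powr_add[symmetric])
  then have "X powr (1 - 2 / p) \<le> A" using assms by simp
  then have "(X powr (1 - 2 / p)) powr (p / (p - 2)) \<le> A powr (p / (p - 2))"
    using assms by (intro powr_mono2) auto
  moreover have "(1 - 2 / p) * (p / (p - 2)) = 1" using assms by (simp add: field_simps)
  ultimately show ?thesis using assms by (simp add: powr_powr)
qed

section \<open>The open unit ball of \<open>\<ell>\<^sub>p\<^sup>n\<close>\<close>

definition pmass :: "real \<Rightarrow> nat \<Rightarrow> (nat \<Rightarrow> real) \<Rightarrow> real" where
  "pmass p n x = (\<Sum>i<n. \<bar>x i\<bar> powr p)"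

definition open_lp_ball :: "real \<Rightarrow> nat \<Rightarrow> (nat \<Rightarrow> real) set" where
  "open_lp_ball p n = {x \<in> topspace (Euclidean_space n). pmass p n x < 1}"

lemma pmass_nonneg: "0 \<le> pmass p n x"
  by (simp add: pmass_def sum_nonneg)

lemma pmass_mono:
  assumes "0 < p" "\<And>i. i < n \<Longrightarrow> \<bar>w i\<bar> \<le> \<bar>x i\<bar>"
  shows "pmass p n w \<le> pmass p n x"
  unfolding pmass_def using assms by (intro sum_mono powr_mono2) auto

lemma pmass_scale: "pmass p n (\<lambda>i. t * x i) = \<bar>t\<bar> powr p * pmass p n x"
  by (simp add: pmass_def abs_mult powr_mult sum_distrib_left)

lemma pmass_upd:
  assumes "i < n"
  shows "pmass p n (x(i := t)) = pmass p n (x(i := 0)) + \<bar>t\<bar> powr p"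
proof -
  have "pmass p n (x(i := s)) = \<bar>s\<bar> powr p + (\<Sum>j\<in>{..<n} - {i}. \<bar>x j\<bar> powr p)" for s
    unfolding pmass_def using assms
    by (subst sum.remove[of _ i]) (auto intro!: sum.cong)
  then show ?thesis by simp
qed

lemma continuous_on_pmass:
  assumes "0 < p" shows "continuous_on A (pmass p n)"
proof -
  have "continuous_on A (\<lambda>x. x i)" for i :: nat
    by (rule continuous_on_product_then_coordinatewise[OF continuous_on_id])
  then have "continuous_on A (\<lambda>x. \<Sum>i<n. \<bar>x i\<bar> powr p)"
    using assms by (intro continuous_on_sum continuous_on_powr' continuous_on_rabs continuous_on_const) auto
  then show ?thesis by (simp add: pmass_def[abs_def])
qed

lemma mem_lp_ball_iff:
  assumes "0 < p"
  shows "x \<in> lp_ball p n \<longleftrightarrow> x \<in> topspace (Euclidean_space n) \<and> pmass p n x \<le> 1"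
proof -
  have "s powr (1 / p) \<le> 1 \<longleftrightarrow> s \<le> 1" if "0 \<le> s" for s :: real
    using that assms powr_le1[of "1/p" s] gr_one_powr[of s "1/p"] by (auto simp: not_le[symmetric])
  then show ?thesis
    using pmass_nonneg[of p n x] by (auto simp: lp_ball_def lp_norm_def pmass_def)
qed

lemma openin_open_lp_ball:
  assumes "0 < p" shows "openin (Euclidean_space n) (open_lp_ball p n)"
proof -
  have "open {x. pmass p n x < 1}"
    by (intro open_Collect_less continuous_on_pmass assms continuous_on_const)
  then show ?thesis
    by (auto simp: openin_Euclidean_space_open open_lp_ball_def)
qed

lemma interior_lp_ball:
  assumes "0 < p" shows "interior_Rn n (lp_ball p n) = open_lp_ball p n"
proof (rule equalityI[OF subsetI])
  fix x assume "x \<in> interior_Rn n (lp_ball p n)"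
  then obtain S where "openin (Euclidean_space n) S" "x \<in> S" "S \<subseteq> lp_ball p n"
    unfolding interior_of_def by blast
  moreover from this obtain T where "open T" "S = T \<inter> topspace (Euclidean_space n)"
    using openin_Euclidean_space_open by blast
  ultimately have T: "open T" "x \<in> T" "T \<inter> topspace (Euclidean_space n) \<subseteq> lp_ball p n"
    and x: "x \<in> topspace (Euclidean_space n)"
    by blast+
  have "open ((\<lambda>t i. t * x i) -` T)"
    by (intro open_vimage T continuous_on_coordinatewise_then_product continuous_intros)
  moreover have "1 \<in> (\<lambda>t i. t * x i) -` T" using T by simp
  ultimately obtain e where e: "e > 0" "ball 1 e \<subseteq> (\<lambda>t i. t * x i) -` T" by (meson openE)
  define t where "t = 1 + e / 2"
  have t: "t > 1" using e by (simp add: t_def)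
  have "t \<in> ball 1 e" using e by (simp add: t_def dist_norm)
  with e have "(\<lambda>i. t * x i) \<in> T" by blast
  moreover have "(\<lambda>i. t * x i) \<in> topspace (Euclidean_space n)"
    using x by (simp add: topspace_Euclidean_space)
  ultimately have "(\<lambda>i. t * x i) \<in> lp_ball p n" using T by blast
  then have le: "t powr p * pmass p n x \<le> 1"
    using t by (simp add: mem_lp_ball_iff[OF assms] pmass_scale)
  have "pmass p n x < 1"
  proof (rule ccontr)
    assume "\<not> ?thesis"
    then have "t powr p * 1 \<le> t powr p * pmass p n x" by (intro mult_left_mono) auto
    with le gr_one_powr[OF t assms] show False by simp
  qed
  with x show "x \<in> open_lp_ball p n" by (simp add: open_lp_ball_def)
next
  show "open_lp_ball p n \<subseteq> interior_Rn n (lp_ball p n)"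
    by (intro interior_of_maximal openin_open_lp_ball assms)
      (auto simp: open_lp_ball_def mem_lp_ball_iff[OF assms])
qed

text \<open>
  The barrier property speaks about the frontier of the closed ball; it is used at the points where
  axis parallel lines leave \<open>U\<close>.
\<close>

lemma frontier_lp_ball:
  assumes "0 < p" "z \<in> topspace (Euclidean_space n)" "pmass p n z = 1"
  shows "z \<in> boundary_Rn n (lp_ball p n)"
proof -
  have "lp_ball p n \<subseteq> topspace (Euclidean_space n)" unfolding lp_ball_def by blast
  then have "lp_ball p n \<subseteq> Euclidean_space n closure_of lp_ball p n"
    by (rule closure_of_subset)
  moreover have "z \<in> lp_ball p n"
    unfolding mem_lp_ball_iff[OF assms(1)] using assms by simp
  moreover have "z \<notin> interior_Rn n (lp_ball p n)"
    unfolding interior_lp_ball[OF assms(1)] open_lp_ball_def using assms(3) by auto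
  ultimately show ?thesis unfolding frontier_of_def by blast
qed

lemma pmass_constant_change:
  assumes "S \<subseteq> {..<n}" "\<And>i. i \<in> S \<Longrightarrow> x i = b"
  shows "pmass p n (\<lambda>i. if i \<in> S then c else x i)
    = pmass p n x - real (card S) * (\<bar>b\<bar> powr p - \<bar>c\<bar> powr p)"
proof -
  have "pmass p n y = (\<Sum>i\<in>{..<n} - S. \<bar>y i\<bar> powr p) + (\<Sum>i\<in>S. \<bar>y i\<bar> powr p)" for y
    unfolding pmass_def by (rule sum.subset_diff[OF assms(1)]) simp
  moreover have "(\<Sum>i\<in>S. \<bar>x i\<bar> powr p) = real (card S) * \<bar>b\<bar> powr p"
    using assms(2) by simp
  ultimately show ?thesis by (simp add: algebra_simps)
qed

lemma sum_axis:
  fixes m i :: nat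
  shows "(\<Sum>j<m. f j * (if j = i then s else (0::real))) = (if i < m then f i * s else 0)"
proof -
  have "(\<Sum>j<m. f j * (if j = i then s else 0)) = (\<Sum>j<m. if j = i then f j * s else 0)"
    by (intro sum.cong) auto
  also have "\<dots> = (if i < m then f i * s else 0)"
    by (subst sum.delta) auto
  finally show ?thesis .
qed

section \<open>Symmetric barriers are monotone and blow up along axes\<close>

locale symmetric_lp_barrier =
  fixes p \<nu> :: real and n :: nat and \<Phi> :: "(nat \<Rightarrow> real) \<Rightarrow> real"
  assumes p_gt_2: "p > 2" and n_ge_2: "n \<ge> 2"
    and barrier: "barrier n (lp_ball p n) \<Phi>"
    and nu_sc: "nu_self_concordant \<nu> n (lp_ball p n) \<Phi>"
    and sym: "\<And>x. x \<in> interior_Rn n (lp_ball p n) \<Longrightarrow> \<Phi> x = \<Phi> (\<lambda>i. \<bar>x i\<bar>)"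
begin

abbreviation "U \<equiv> open_lp_ball p n"

lemma p_pos: "0 < p" using p_gt_2 by simp

lemma int_eq: "interior_Rn n (lp_ball p n) = U"
  by (rule interior_lp_ball[OF p_pos])

lemma open_U: "openin (Euclidean_space n) U"
  by (rule openin_open_lp_ball[OF p_pos])

lemma U_D:
  assumes "x \<in> U"
  shows "x \<in> topspace (Euclidean_space n)" "pmass p n x < 1"
  using assms by (auto simp: open_lp_ball_def)

lemma U_mono:
  assumes "x \<in> U" "w \<in> topspace (Euclidean_space n)" "\<And>i. i < n \<Longrightarrow> \<bar>w i\<bar> \<le> \<bar>x i\<bar>"
  shows "w \<in> U"
proof -
  have "pmass p n w \<le> pmass p n x" using assms by (intro pmass_mono p_pos)
  with assms show ?thesis by (simp add: open_lp_ball_def)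
qed

lemma smooth_Phi: "smooth_Rn n 3 U \<Phi>"
  using nu_sc by (simp add: nu_self_concordant_def self_concordant_def int_eq)

lemma Phi_convex:
  assumes "x \<in> U" "y \<in> U" "0 \<le> u" "0 \<le> v" "u + v = 1"
  shows "(\<lambda>i. u * x i + v * y i) \<in> U" "\<Phi> (\<lambda>i. u * x i + v * y i) \<le> u * \<Phi> x + v * \<Phi> y"
  using nu_sc assms
  by (simp_all add: nu_self_concordant_def self_concordant_def int_eq convex_fun_on_def)

text \<open>
  A symmetric convex function is even in each coordinate, and \<open>z(i := s)\<close> is a convex combination of
  \<open>z(i := t)\<close> and \<open>z(i := - t)\<close>.
\<close>

lemma coord_upd_mono:
  assumes "z(i := t) \<in> U" "\<bar>s\<bar> \<le> \<bar>t\<bar>" "i < n"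
  shows "z(i := s) \<in> U" "\<Phi> (z(i := s)) \<le> \<Phi> (z(i := t))"
proof -
  have E: "z(i := r) \<in> topspace (Euclidean_space n)" for r
    using U_D(1)[OF assms(1)] assms(3) by (auto simp: topspace_Euclidean_space)
  have m: "z(i := r) \<in> U" if "\<bar>r\<bar> \<le> \<bar>t\<bar>" for r
    by (rule U_mono[OF assms(1) E]) (use that in auto)
  show "z(i := s) \<in> U" using m assms(2) by blast
  have even: "\<Phi> (z(i := - t)) = \<Phi> (z(i := t))"
  proof -
    have "(\<lambda>j. \<bar>(z(i := - t)) j\<bar>) = (\<lambda>j. \<bar>(z(i := t)) j\<bar>)" by auto
    then show ?thesis using sym[of "z(i := t)"] sym[of "z(i := - t)"] m[of t] m[of "-t"]
      by (simp add: int_eq)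
  qed
  show "\<Phi> (z(i := s)) \<le> \<Phi> (z(i := t))"
  proof (cases "t = 0")
    case True
    then show ?thesis using assms by simp
  next
    case False
    define u where "u = (1 + s / t) / 2"
    have "\<bar>s / t\<bar> \<le> 1" using False assms(2) unfolding abs_divide by simp
    then have "- 1 \<le> s / t" "s / t \<le> 1" unfolding abs_le_iff by linarith+
    then have u: "0 \<le> u" "0 \<le> 1 - u" unfolding u_def by simp_all
    have "(\<lambda>j. u * (z(i := t)) j + (1 - u) * (z(i := - t)) j) = z(i := s)"
      using False by (auto simp: u_def field_simps)
    then have "\<Phi> (z(i := s)) \<le> u * \<Phi> (z(i := t)) + (1 - u) * \<Phi> (z(i := - t))"
      using Phi_convex(2)[of "z(i := t)" "z(i := - t)" u "1 - u"] m u by simp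
    then show ?thesis by (simp add: even algebra_simps)
  qed
qed

lemma Phi_mono:
  assumes x: "x \<in> U" and w: "w \<in> topspace (Euclidean_space n)"
    and le: "\<And>i. i < n \<Longrightarrow> \<bar>w i\<bar> \<le> \<bar>x i\<bar>"
  shows "\<Phi> w \<le> \<Phi> x"
proof -
  define y where "y = (\<lambda>k i. if i < k then w i else x i)"
  have E: "y k \<in> topspace (Euclidean_space n)" for k
    using w U_D(1)[OF x] by (auto simp: y_def topspace_Euclidean_space)
  have yU: "y k \<in> U" for k
    by (rule U_mono[OF x E]) (use le in \<open>auto simp: y_def\<close>)
  have "k \<le> n \<Longrightarrow> \<Phi> (y k) \<le> \<Phi> x" for k
  proof (induction k)
    case 0
    then show ?case by (simp add: y_def)
  next
    case (Suc k)
    have 1: "y (Suc k) = (y k)(k := w k)" and 2: "(y k)(k := x k) = y k"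
      by (auto simp: y_def)
    have "\<Phi> ((y k)(k := w k)) \<le> \<Phi> ((y k)(k := x k))"
      by (rule coord_upd_mono(2)) (use Suc.prems le in \<open>auto simp: 2 yU\<close>)
    then have "\<Phi> (y (Suc k)) \<le> \<Phi> (y k)" unfolding 1 2 .
    then show ?case using Suc by simp
  qed
  moreover have "y n = w"
    using w U_D(1)[OF x] by (auto simp: y_def topspace_Euclidean_space)
  ultimately show ?thesis by auto
qed

lemma open_coord_line:
  assumes "x \<in> topspace (Euclidean_space n)" "i < n"
  shows "open {t. x(i := t) \<in> U}"
proof -
  define R where "R = pmass p n (x(i := 0))"
  have "open {t. R + \<bar>t\<bar> powr p < 1}"
    using p_pos by (intro open_Collect_less continuous_on_add continuous_on_const
        continuous_on_powr' continuous_on_rabs continuous_on_id) auto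
  moreover have "x(i := t) \<in> topspace (Euclidean_space n)" for t
    using assms by (auto simp: topspace_Euclidean_space)
  moreover have "pmass p n (x(i := t)) = R + \<bar>t\<bar> powr p" for t
    unfolding R_def by (rule pmass_upd[OF assms(2)])
  ultimately show ?thesis by (simp add: open_lp_ball_def)
qed

lemma partial_deriv_origin:
  assumes "i < n" "z(i := 0) \<in> U"
  shows "partial_deriv i \<Phi> (z(i := 0)) = 0"
proof -
  have "open {t. (z(i := 0))(i := t) \<in> U}"
    using assms U_D(1) by (intro open_coord_line) auto
  then obtain d where d: "d > 0" "ball 0 d \<subseteq> {t. z(i := t) \<in> U}"
    using assms openE[of "{t. z(i := t) \<in> U}" 0] by auto
  have "((\<lambda>t. \<Phi> (z(i := t))) has_real_derivative partial_deriv i \<Phi> (z(i := 0))) (at 0)"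
    using assms by (intro partial_deriv_has_field_derivative[OF smooth_Phi[unfolded numeral_3_eq_3]])
  then show ?thesis
  proof (rule DERIV_local_min[OF _ d(1)], intro allI impI)
    fix t :: real assume "\<bar>0 - t\<bar> < d"
    then have "z(i := t) \<in> U" using d by auto
    then show "\<Phi> (z(i := 0)) \<le> \<Phi> (z(i := t))" by (rule coord_upd_mono(2)) (use assms in auto)
  qed
qed

lemma D2_axis:
  "D2 n \<Phi> x (\<lambda>j. if j = i then s else 0) (\<lambda>j. if j = i then s else 0)
    = (if i < n then partial_deriv i (partial_deriv i \<Phi>) x * s * s else 0)"
  unfolding D2_def sum_axis by (cases "i < n") (simp_all add: sum_axis sum_distrib_right[symmetric])

lemma D3_axis:
  "D3 n \<Phi> x (\<lambda>j. if j = i then s else 0) (\<lambda>j. if j = i then s else 0) (\<lambda>j. if j = i then s else 0)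
    = (if i < n then partial_deriv i (partial_deriv i (partial_deriv i \<Phi>)) x * s * s * s else 0)"
  unfolding D3_def sum_axis by (cases "i < n") (simp_all add: sum_axis sum_distrib_right[symmetric])

text \<open>
  A line that leaves the ball crosses its frontier, and \<open>\<Phi>\<close> blows up there. This lets the boundary
  play the same role as an actual rise of \<open>\<Phi>\<close> by 1.
\<close>

lemma exit_rise:
  assumes "i < n" "z(i := 0) \<in> U" "z(i := v) \<notin> U" "0 < v"
  shows "\<exists>t. 0 \<le> t \<and> t \<le> v \<and> z(i := t) \<in> U \<and> \<Phi> (z(i := t)) \<ge> \<Phi> (z(i := 0)) + 1"
proof -
  have E: "z(i := t) \<in> topspace (Euclidean_space n)" for t
    using U_D(1)[OF assms(2)] assms(1) by (auto simp: topspace_Euclidean_space)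
  define R where "R = pmass p n (z(i := 0))"
  have pm: "pmass p n (z(i := t)) = R + \<bar>t\<bar> powr p" for t
    unfolding R_def by (rule pmass_upd[OF assms(1)])
  have "R < 1" using U_D(2)[OF assms(2)] by (simp add: R_def)
  define r where "r = (1 - R) powr (1 / p)"
  have r: "r > 0" "r powr p = 1 - R"
    using \<open>R < 1\<close> p_pos by (simp_all add: r_def powr_powr)
  have "r \<le> v"
  proof (rule ccontr)
    assume "\<not> r \<le> v"
    then have "v powr p < r powr p" using assms p_pos by (intro powr_less_mono2) auto
    then show False using assms(3,4) E r by (simp add: open_lp_ball_def pm)
  qed
  have "z(i := r) \<in> boundary_Rn n (lp_ball p n)"
    using E r by (intro frontier_lp_ball p_pos) (auto simp: pm)
  then have "filterlim \<Phi> at_top (atin_within (Euclidean_space n) (z(i := r)) U)"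
    using barrier by (simp add: barrier_def int_eq)
  then have "eventually (\<lambda>x. \<Phi> x \<ge> \<Phi> (z(i := 0)) + 1)
      (atin_within (Euclidean_space n) (z(i := r)) U)"
    by (simp add: filterlim_at_top)
  then obtain S where S: "openin (Euclidean_space n) S" "z(i := r) \<in> S"
    "\<And>x. x \<in> S \<Longrightarrow> x \<in> U \<Longrightarrow> x \<noteq> z(i := r) \<Longrightarrow> \<Phi> x \<ge> \<Phi> (z(i := 0)) + 1"
    using E by (auto simp: eventually_atin_within)
  then obtain T where T: "open T" "S = T \<inter> topspace (Euclidean_space n)"
    by (auto simp: openin_Euclidean_space_open)
  have "open ((\<lambda>t. z(i := t)) -` T)"
    unfolding fun_upd_def
  proof (intro open_vimage T continuous_on_coordinatewise_then_product)
    show "continuous_on UNIV (\<lambda>t::real. if j = i then t else z j)" for j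
      by (cases "j = i") (auto intro: continuous_intros)
  qed
  then obtain d where d: "d > 0" "ball r d \<subseteq> (\<lambda>t. z(i := t)) -` T"
    using S T openE[of _ r] by (metis IntD1 vimageI2)
  define t where "t = max (r / 2) (r - d / 2)"
  have t: "0 \<le> t" "t < r" "t \<in> ball r d" using r d by (auto simp: t_def dist_real_def)
  have "z(i := t) \<in> S" using t d T E by auto
  moreover have "t powr p < r powr p" using t p_pos by (intro powr_less_mono2) auto
  then have "z(i := t) \<in> U" using E t r by (simp add: open_lp_ball_def pm)
  moreover have "z(i := t) \<noteq> z(i := r)" using t by (auto dest: fun_cong[of _ _ i])
  ultimately show ?thesis using S(3) t \<open>r \<le> v\<close> by (intro exI[of _ t]) auto
qed

section \<open>Curvature along axes and slope along arbitrary directions\<close>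

lemma smooth_partials:
  assumes "i < n"
  shows "smooth_Rn n (Suc (Suc 0)) U (partial_deriv i \<Phi>)"
    "j < n \<Longrightarrow> smooth_Rn n (Suc 0) U (partial_deriv j (partial_deriv i \<Phi>))"
  using smooth_Phi assms by (simp_all add: numeral_3_eq_3)

lemma D1_le:
  assumes "x \<in> U" "h \<in> topspace (Euclidean_space n)"
  shows "D1 n \<Phi> x h \<le> sqrt (\<nu> * D2 n \<Phi> x h h)"
  using nu_sc assms by (simp add: nu_self_concordant_def int_eq)

lemma D3_le:
  assumes "x \<in> U" "h \<in> topspace (Euclidean_space n)"
  shows "D3 n \<Phi> x h h h \<le> 2 * D2 n \<Phi> x h h powr (3/2)"
  using nu_sc assms by (simp add: nu_self_concordant_def self_concordant_def int_eq)

lemma nu_nonneg: "0 \<le> \<nu>"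
  using nu_sc by (simp add: nu_self_concordant_def)

lemma D1_uminus: "D1 n \<Phi> x (\<lambda>i. - h i) = - D1 n \<Phi> x h"
  by (simp add: D1_def sum_negf)

lemma D2_uminus: "D2 n \<Phi> x (\<lambda>i. - h i) (\<lambda>i. - h i) = D2 n \<Phi> x h h"
  by (simp add: D2_def)

lemma axis_in_space:
  "i < n \<Longrightarrow> (\<lambda>j. if j = i then s else 0) \<in> topspace (Euclidean_space n)"
  by (auto simp: topspace_Euclidean_space)

lemma coord_has_derivative:
  assumes "i < n" "z(i := t) \<in> U"
  shows "((\<lambda>s. \<Phi> (z(i := s))) has_real_derivative partial_deriv i \<Phi> (z(i := t))) (at t)"
    "((\<lambda>s. partial_deriv i \<Phi> (z(i := s))) has_real_derivative
        partial_deriv i (partial_deriv i \<Phi>) (z(i := t))) (at t)"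
    "((\<lambda>s. partial_deriv i (partial_deriv i \<Phi>) (z(i := s))) has_real_derivative
        partial_deriv i (partial_deriv i (partial_deriv i \<Phi>)) (z(i := t))) (at t)"
  using smooth_Phi smooth_partials assms
  by (auto simp only: numeral_3_eq_3 intro!: partial_deriv_has_field_derivative)

lemma zero_in_U: "(\<lambda>_. 0) \<in> U"
  using p_pos by (simp add: open_lp_ball_def topspace_Euclidean_space pmass_def)

lemma unit_vector_notin_U:
  assumes "i < n" shows "(\<lambda>_. 0)(i := 1) \<notin> U"
  using pmass_upd[OF assms, of p "\<lambda>_. 0" 1] pmass_nonneg[of p n "(\<lambda>_. 0)(i := 0)"]
  by (auto simp: open_lp_ball_def)

text \<open>
  With \<open>\<nu> = 0\<close> the gradient would vanish, which the barrier property excludes.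
\<close>

lemma nu_pos: "0 < \<nu>"
proof (rule ccontr)
  assume "\<not> 0 < \<nu>"
  then have "\<nu> = 0" using nu_nonneg by simp
  have n: "0 < n" using n_ge_2 by simp
  have flat: "partial_deriv 0 \<Phi> x = 0" if "x \<in> U" for x
  proof -
    have "D1 n \<Phi> x (\<lambda>j. if j = 0 then s else 0) = partial_deriv 0 \<Phi> x * s" for s
      using n by (simp add: D1_def sum_axis)
    moreover have "D1 n \<Phi> x (\<lambda>j. if j = 0 then s else 0) \<le> 0" for s
      using D1_le[OF that axis_in_space[OF n]] \<open>\<nu> = 0\<close> by (metis mult_zero_left real_sqrt_zero)
    ultimately have "partial_deriv 0 \<Phi> x * s \<le> 0" for s by metis
    from this[of 1] this[of "-1"] show ?thesis by simp
  qed
  let ?z = "\<lambda>t::real. (\<lambda>_::nat. 0::real)(0 := t)"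
  have z0: "?z 0 \<in> U" using zero_in_U by (simp add: fun_upd_idem)
  obtain t where t: "0 \<le> t" "?z t \<in> U" "\<Phi> (?z t) \<ge> \<Phi> (?z 0) + 1"
    using exit_rise[OF n z0 unit_vector_notin_U[OF n]] by auto
  have in_U: "?z s \<in> U" if "0 \<le> s" "s \<le> t" for s
    by (rule coord_upd_mono(1)[OF t(2)]) (use that n in auto)
  have "t > 0" using t by (cases "t = 0") auto
  then obtain s where "0 < s" "s < t" "\<Phi> (?z t) - \<Phi> (?z 0) = (t - 0) * partial_deriv 0 \<Phi> (?z s)"
    using MVT2[of 0 t "\<lambda>s. \<Phi> (?z s)" "\<lambda>s. partial_deriv 0 \<Phi> (?z s)"]
      coord_has_derivative(1)[OF n in_U] by auto
  then show False using flat[OF in_U[of s]] t by simp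
qed

text \<open>
  The square root in the gradient bound is an odd function; adding the bounds for \<open>h\<close> and \<open>- h\<close> shows
  that its argument is nonnegative.
\<close>

lemma D2_nonneg:
  assumes "x \<in> U" "h \<in> topspace (Euclidean_space n)"
  shows "0 \<le> D2 n \<Phi> x h h"
proof -
  have "(\<lambda>i. - h i) \<in> topspace (Euclidean_space n)"
    using assms(2) by (simp add: topspace_Euclidean_space)
  from D1_le[OF assms] D1_le[OF assms(1) this]
  have "0 \<le> sqrt (\<nu> * D2 n \<Phi> x h h)" unfolding D1_uminus D2_uminus by linarith
  then show ?thesis using nu_pos by (simp add: zero_le_mult_iff)
qed

lemma rise_curvature:
  assumes "i < n" "z(i := t) \<in> U" "z(i := s) \<in> U" "0 \<le> t" "t \<le> v" "0 \<le> s" "s \<le> v" "0 < v"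
    and "\<Phi> (z(i := t)) \<ge> \<Phi> (z(i := 0)) + 1"
  shows "partial_deriv i (partial_deriv i \<Phi>) (z(i := s)) \<ge> 1 / (4 * v\<^sup>2)"
proof (rule sc_curvature_bound[where I = "{t. z(i := t) \<in> U}" and t = t and s = s and v = v
      and \<phi> = "\<lambda>r. \<Phi> (z(i := r))" and ?\<phi>1.0 = "\<lambda>r. partial_deriv i \<Phi> (z(i := r))"
      and ?\<phi>2.0 = "\<lambda>r. partial_deriv i (partial_deriv i \<Phi>) (z(i := r))"
      and ?\<phi>3.0 = "\<lambda>r. partial_deriv i (partial_deriv i (partial_deriv i \<Phi>)) (z(i := r))"])
  have nonneg: "0 \<le> partial_deriv i (partial_deriv i \<Phi>) x" if "x \<in> U" for x
    using D2_nonneg[OF that axis_in_space[OF assms(1), of 1]] assms(1) by (simp add: D2_axis)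
  show "0 \<le> partial_deriv i (partial_deriv i \<Phi>) (z(i := r))" if "r \<in> {t. z(i := t) \<in> U}" for r
    using nonneg that by simp
  show "\<bar>partial_deriv i (partial_deriv i (partial_deriv i \<Phi>)) (z(i := r))\<bar>
      \<le> 2 * partial_deriv i (partial_deriv i \<Phi>) (z(i := r)) powr (3/2)"
    if "r \<in> {t. z(i := t) \<in> U}" for r
    using D3_le[OF _ axis_in_space[OF assms(1), of 1], of "z(i := r)"]
      D3_le[OF _ axis_in_space[OF assms(1), of "-1"], of "z(i := r)"] that assms(1)
    by (simp add: D2_axis D3_axis abs_le_iff)
  show "partial_deriv i \<Phi> (z(i := 0)) = 0"
    by (rule partial_deriv_origin[OF assms(1) coord_upd_mono(1)[OF assms(2)]]) (use assms in auto)
  show "{0..max t s} \<subseteq> {t. z(i := t) \<in> U}"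
  proof
    fix r assume r: "r \<in> {0..max t s}"
    have "z(i := max t s) \<in> U" using assms by (auto simp: max_def)
    then have "z(i := r) \<in> U" by (rule coord_upd_mono(1)) (use r assms in auto)
    then show "r \<in> {t. z(i := t) \<in> U}" by simp
  qed
qed (use assms in \<open>auto intro: coord_has_derivative\<close>)

text \<open>
  The first of the two basic estimates: integrating the curvature bound twice from the critical point
  \<open>z(i := 0)\<close>. When \<open>z(i := v)\<close> lies outside the ball, \<open>exit_rise\<close> supplies the rise.
\<close>

lemma coord_increment:
  assumes "i < n" "0 \<le> a" "a \<le> b" "b \<le> v" "0 < v" "z(i := b) \<in> U"
    and rise: "z(i := v) \<in> U \<Longrightarrow> \<Phi> (z(i := v)) \<ge> \<Phi> (z(i := 0)) + 1"
  shows "\<Phi> (z(i := b)) - \<Phi> (z(i := a)) \<ge> (b - a) * a / (4 * v\<^sup>2)"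
proof -
  have in_U: "z(i := s) \<in> U" if "0 \<le> s" "s \<le> b" for s
    by (rule coord_upd_mono(1)[OF assms(6)]) (use that assms in auto)
  have "\<exists>t. 0 \<le> t \<and> t \<le> v \<and> z(i := t) \<in> U \<and> \<Phi> (z(i := t)) \<ge> \<Phi> (z(i := 0)) + 1"
  proof (cases "z(i := v) \<in> U")
    case True
    then show ?thesis using rise assms by (intro exI[of _ v]) auto
  next
    case False
    then show ?thesis using exit_rise[OF assms(1) in_U[of 0]] assms by auto
  qed
  then obtain t where t: "0 \<le> t" "t \<le> v" "z(i := t) \<in> U" "\<Phi> (z(i := t)) \<ge> \<Phi> (z(i := 0)) + 1"
    by blast
  have curv: "partial_deriv i (partial_deriv i \<Phi>) (z(i := s)) \<ge> 1 / (4 * v\<^sup>2)"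
    if "0 \<le> s" "s \<le> b" for s
    by (rule rise_curvature[OF assms(1) t(3) in_U[OF that] t(1,2) _ _ _ t(4)]) (use that assms in auto)
  show ?thesis
  proof (cases "a = b")
    case True
    then show ?thesis by simp
  next
    case False
    then have "a < b" using assms by simp
    then obtain r where r: "a < r" "r < b"
      "\<Phi> (z(i := b)) - \<Phi> (z(i := a)) = (b - a) * partial_deriv i \<Phi> (z(i := r))"
      using MVT2[of a b "\<lambda>s. \<Phi> (z(i := s))" "\<lambda>s. partial_deriv i \<Phi> (z(i := s))"]
        coord_has_derivative(1)[OF assms(1) in_U] assms by auto
    then obtain q where q: "0 < q" "q < r"
      "partial_deriv i \<Phi> (z(i := r)) - partial_deriv i \<Phi> (z(i := 0))
        = (r - 0) * partial_deriv i (partial_deriv i \<Phi>) (z(i := q))"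
      using MVT2[of 0 r "\<lambda>s. partial_deriv i \<Phi> (z(i := s))"
          "\<lambda>s. partial_deriv i (partial_deriv i \<Phi>) (z(i := s))"]
        coord_has_derivative(2)[OF assms(1) in_U] assms by auto
    have "partial_deriv i \<Phi> (z(i := 0)) = 0"
      by (rule partial_deriv_origin[OF assms(1) in_U]) (use assms in auto)
    then have "partial_deriv i \<Phi> (z(i := r)) = r * partial_deriv i (partial_deriv i \<Phi>) (z(i := q))"
      using q by simp
    also have "\<dots> \<ge> a * (1 / (4 * v\<^sup>2))"
      using q r assms curv[of q] by (intro mult_mono) auto
    finally have "(b - a) * (a * (1 / (4 * v\<^sup>2))) \<le> (b - a) * partial_deriv i \<Phi> (z(i := r))"
      using \<open>a < b\<close> by (intro mult_left_mono) auto
    then show ?thesis using r by simp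
  qed
qed

lemma line_has_derivative:
  assumes "(\<lambda>i. x i + t * h i) \<in> U" "h \<in> topspace (Euclidean_space n)"
  shows "((\<lambda>t. \<Phi> (\<lambda>i. x i + t * h i)) has_real_derivative D1 n \<Phi> (\<lambda>i. x i + t * h i) h) (at t)"
    "((\<lambda>t. D1 n \<Phi> (\<lambda>i. x i + t * h i) h) has_real_derivative
        D2 n \<Phi> (\<lambda>i. x i + t * h i) h h) (at t)"
proof -
  show "((\<lambda>t. \<Phi> (\<lambda>i. x i + t * h i)) has_real_derivative D1 n \<Phi> (\<lambda>i. x i + t * h i) h) (at t)"
    unfolding D1_def
    by (rule has_real_derivative_line[OF smooth_Phi[unfolded numeral_3_eq_3] open_U assms])
  have "((\<lambda>t. partial_deriv j \<Phi> (\<lambda>i. x i + t * h i) * h j) has_real_derivative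
      (\<Sum>i<n. partial_deriv i (partial_deriv j \<Phi>) (\<lambda>i. x i + t * h i) * h i) * h j) (at t)"
    if "j < n" for j
    by (intro DERIV_cmult_right
        has_real_derivative_line[OF smooth_partials(1)[OF that] open_U assms])
  then have "((\<lambda>t. \<Sum>j<n. partial_deriv j \<Phi> (\<lambda>i. x i + t * h i) * h j) has_real_derivative
      (\<Sum>j<n. (\<Sum>i<n. partial_deriv i (partial_deriv j \<Phi>) (\<lambda>i. x i + t * h i) * h i) * h j)) (at t)"
    by (intro DERIV_sum) auto
  moreover have "(\<Sum>j<n. (\<Sum>i<n. partial_deriv i (partial_deriv j \<Phi>) y * h i) * h j) = D2 n \<Phi> y h h" for y
    unfolding D2_def sum_distrib_right by (rule sum.swap)
  ultimately show "((\<lambda>t. D1 n \<Phi> (\<lambda>i. x i + t * h i) h) has_real_derivative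
        D2 n \<Phi> (\<lambda>i. x i + t * h i) h h) (at t)"
    unfolding D1_def by simp
qed

lemma segment_in_U:
  assumes "(\<lambda>i. x i + a * h i) \<in> U" "(\<lambda>i. x i + b * h i) \<in> U" "a \<le> t" "t \<le> b"
  shows "(\<lambda>i. x i + t * h i) \<in> U"
proof (cases "a = b")
  case True
  then show ?thesis using assms by (metis antisym)
next
  case False
  then have "a < b" using assms by simp
  define u where "u = (b - t) / (b - a)"
  have "0 \<le> u" "0 \<le> 1 - u" using assms \<open>a < b\<close> by (auto simp: u_def field_simps)
  then have "(\<lambda>i. u * (x i + a * h i) + (1 - u) * (x i + b * h i)) \<in> U"
    using Phi_convex(1)[OF assms(1,2), of u "1 - u"] by simp
  moreover have "u * a + (1 - u) * b = t"
  proof -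
    have "u * (b - a) = b - t" using \<open>a < b\<close> by (simp add: u_def)
    then show ?thesis by (simp add: algebra_simps)
  qed
  moreover have "u * (x i + a * h i) + (1 - u) * (x i + b * h i)
      = x i + (u * a + (1 - u) * b) * h i" for i
    by (simp add: algebra_simps)
  ultimately show ?thesis by simp
qed

lemma D1_mono_line:
  assumes "(\<lambda>i. x i + a * h i) \<in> U" "(\<lambda>i. x i + b * h i) \<in> U" "a \<le> b"
    and h: "h \<in> topspace (Euclidean_space n)"
  shows "D1 n \<Phi> (\<lambda>i. x i + a * h i) h \<le> D1 n \<Phi> (\<lambda>i. x i + b * h i) h"
proof (rule DERIV_nonneg_imp_nondecreasing[OF \<open>a \<le> b\<close>])
  fix t assume "a \<le> t" "t \<le> b"
  then have "(\<lambda>i. x i + t * h i) \<in> U" using assms segment_in_U by blast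
  then show "\<exists>y. ((\<lambda>t. D1 n \<Phi> (\<lambda>i. x i + t * h i) h) has_real_derivative y) (at t) \<and> 0 \<le> y"
    using line_has_derivative(2)[OF _ h] D2_nonneg[OF _ h] by blast
qed

text \<open>
  Along the segment from \<open>x\<close> to \<open>x + h\<close> the slope \<open>\<psi>'\<close> satisfies \<open>\<psi>'\<^sup>2 \<le> \<nu> \<psi>''\<close>, so \<open>1/\<psi>'\<close> decreases at rate
  at least \<open>1/\<nu>\<close> as long as \<open>\<psi>'\<close> is positive. Starting with \<open>\<psi>' > \<nu>\<close> it would reach 0 within unit time.
\<close>

lemma D1_le_nu:
  assumes x: "x \<in> U" and xh: "(\<lambda>i. x i + h i) \<in> U"
    and h: "h \<in> topspace (Euclidean_space n)"
  shows "D1 n \<Phi> x h \<le> \<nu>"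
proof (rule ccontr)
  assume "\<not> ?thesis"
  then have big: "\<nu> < D1 n \<Phi> x h" by simp
  define \<psi>1 where "\<psi>1 = (\<lambda>t. D1 n \<Phi> (\<lambda>i. x i + t * h i) h)"
  define \<psi>2 where "\<psi>2 = (\<lambda>t. D2 n \<Phi> (\<lambda>i. x i + t * h i) h h)"
  have 0: "\<psi>1 0 = D1 n \<Phi> x h" by (simp add: \<psi>1_def)
  have in_U: "(\<lambda>i. x i + t * h i) \<in> U" if "0 \<le> t" "t \<le> 1" for t
    by (rule segment_in_U[of _ 0 _ 1]) (use x xh that in auto)
  have pos: "\<psi>1 t > \<nu>" if "0 \<le> t" "t \<le> 1" for t
    using D1_mono_line[OF in_U[of 0] in_U[OF that] that(1) h] big by (simp add: \<psi>1_def)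
  have der: "((\<lambda>t. - inverse (\<psi>1 t)) has_real_derivative \<psi>2 t / (\<psi>1 t)\<^sup>2) (at t)"
    if "0 \<le> t" "t \<le> 1" for t
  proof -
    have "(\<psi>1 has_real_derivative \<psi>2 t) (at t)"
      unfolding \<psi>1_def \<psi>2_def by (rule line_has_derivative(2)[OF in_U[OF that] h])
    then show ?thesis using pos[OF that] nu_pos
      by (auto intro!: derivative_eq_intros simp: power2_eq_square field_simps)
  qed
  obtain t where t: "0 < t" "t < 1"
    "- inverse (\<psi>1 1) - - inverse (\<psi>1 0) = (1 - 0) * (\<psi>2 t / (\<psi>1 t)\<^sup>2)"
    using MVT2[of 0 1 "\<lambda>t. - inverse (\<psi>1 t)" "\<lambda>t. \<psi>2 t / (\<psi>1 t)\<^sup>2"] der by auto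
  have "\<psi>1 t \<le> sqrt (\<nu> * \<psi>2 t)"
    unfolding \<psi>1_def \<psi>2_def using t by (intro D1_le in_U h) auto
  then have "(\<psi>1 t)\<^sup>2 \<le> \<nu> * \<psi>2 t"
    using pos[of t] t nu_pos by (metis less_imp_le less_trans real_le_rsqrt sqrt_ge_absD abs_of_pos)
  then have "1 / \<nu> \<le> \<psi>2 t / (\<psi>1 t)\<^sup>2"
    using pos[of t] t nu_pos by (simp add: field_simps)
  moreover have "inverse (\<psi>1 1) > 0" using pos[of 1] nu_pos by simp
  moreover have "inverse (\<psi>1 0) < 1 / \<nu>" using pos[of 0] nu_pos by (simp add: field_simps)
  moreover have "inverse (\<psi>1 0) - inverse (\<psi>1 1) = \<psi>2 t / (\<psi>1 t)\<^sup>2" using t(3) by simp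
  ultimately show False by linarith
qed

text \<open>
  The second of the two basic estimates: by convexity the slope at \<open>x\<close> is the largest one on the
  way from \<open>x - \<eta> h\<close> to \<open>x\<close>.
\<close>

lemma Phi_drop_le:
  assumes x: "x \<in> U" and xh: "(\<lambda>i. x i + h i) \<in> U" and xm: "(\<lambda>i. x i - \<eta> * h i) \<in> U"
    and h: "h \<in> topspace (Euclidean_space n)" and "0 \<le> \<eta>"
  shows "\<Phi> x - \<Phi> (\<lambda>i. x i - \<eta> * h i) \<le> \<eta> * \<nu>"
proof (cases "\<eta> = 0")
  case True
  then show ?thesis by simp
next
  case False
  then have "- \<eta> < 0" using assms by simp
  have in_U: "(\<lambda>i. x i + t * h i) \<in> U" if "- \<eta> \<le> t" "t \<le> 0" for t
    by (rule segment_in_U[of _ "- \<eta>" _ 0]) (use x xm that in auto)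
  obtain t where t: "- \<eta> < t" "t < 0"
    "\<Phi> (\<lambda>i. x i + 0 * h i) - \<Phi> (\<lambda>i. x i + (- \<eta>) * h i)
      = (0 - (- \<eta>)) * D1 n \<Phi> (\<lambda>i. x i + t * h i) h"
    using MVT2[OF \<open>- \<eta> < 0\<close>, of "\<lambda>t. \<Phi> (\<lambda>i. x i + t * h i)"
        "\<lambda>t. D1 n \<Phi> (\<lambda>i. x i + t * h i) h"] line_has_derivative(1)[OF in_U h] by auto
  have "D1 n \<Phi> (\<lambda>i. x i + t * h i) h \<le> D1 n \<Phi> (\<lambda>i. x i + 0 * h i) h"
    by (rule D1_mono_line[OF in_U in_U _ h]) (use t \<open>0 \<le> \<eta>\<close> in auto)
  also have "\<dots> \<le> \<nu>" using D1_le_nu[OF x xh h] by simp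
  finally have "\<eta> * D1 n \<Phi> (\<lambda>i. x i + t * h i) h \<le> \<eta> * \<nu>"
    using \<open>0 \<le> \<eta>\<close> by (rule mult_left_mono)
  then show ?thesis using t(3) by simp
qed

text \<open>
  The curvature bound on a diameter of the ball along a coordinate axis, compared with the slope bound.
\<close>

lemma nu_ge: "1 / 64 \<le> \<nu>"
proof -
  have n: "0 < n" using n_ge_2 by simp
  let ?z = "\<lambda>t::real. (\<lambda>_::nat. 0::real)(0 := t)"
  have in_U: "?z t \<in> U" if "0 \<le> t" "t < 1" for t
  proof -
    have "t powr p < 1 powr p" using that p_pos by (intro powr_less_mono2) auto
    moreover have "pmass p n (?z 0) = 0" using p_pos by (simp add: pmass_def fun_upd_idem)
    ultimately have "pmass p n (?z t) < 1" using pmass_upd[OF n, of p "\<lambda>_. 0" t] that by simp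
    then show ?thesis using n by (auto simp: open_lp_ball_def topspace_Euclidean_space)
  qed
  have "(1/2 - 1/4) * (1/4) / (4 * 1\<^sup>2) \<le> \<Phi> (?z (1/2)) - \<Phi> (?z (1/4))"
    by (rule coord_increment[OF n]) (use in_U unit_vector_notin_U[OF n] in auto)
  moreover have "\<Phi> (?z (1/2)) - \<Phi> (?z (1/4)) \<le> 1 * \<nu>"
  proof -
    have *: "(\<lambda>i. ?z (1/2) i - 1 * ?z (1/4) i) = ?z (1/4)" by auto
    have "(\<lambda>i. ?z (1/2) i + ?z (1/4) i) = ?z (3/4)" by auto
    then have plus: "(\<lambda>i. ?z (1/2) i + ?z (1/4) i) \<in> U" using in_U by simp
    have minus: "(\<lambda>i. ?z (1/2) i - 1 * ?z (1/4) i) \<in> U" unfolding * using in_U by simp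
    have "\<Phi> (?z (1/2)) - \<Phi> (\<lambda>i. ?z (1/2) i - 1 * ?z (1/4) i) \<le> 1 * \<nu>"
      by (rule Phi_drop_le[OF in_U plus minus U_D(1)[OF in_U]]) auto
    then show ?thesis unfolding * .
  qed
  ultimately show ?thesis by simp
qed

section \<open>Points with a floor\<close>

text \<open>
  The coordinates in \<open>S\<close> are lowered one after the other. The hypothesis on rises is therefore needed at
  all intermediate points, where only a part \<open>T\<close> of \<open>S\<close> has been lowered.
\<close>

lemma lowering_drop:
  assumes x: "x \<in> U" and S: "S \<subseteq> {..<n}" "\<And>i. i \<in> S \<Longrightarrow> x i = b"
    and c: "0 \<le> c" "c \<le> b" "b \<le> v" "0 < v"
    and rise: "\<And>T i z. T \<subseteq> S \<Longrightarrow> i \<in> S - T \<Longrightarrow> z = (\<lambda>j. if j \<in> T then c else x j) \<Longrightarrow>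
      z(i := v) \<in> U \<Longrightarrow> \<Phi> (z(i := v)) \<ge> \<Phi> (z(i := 0)) + 1"
  shows "real (card S) * ((b - c) * c / (4 * v\<^sup>2)) \<le> \<Phi> x - \<Phi> (\<lambda>j. if j \<in> S then c else x j)"
proof -
  define \<kappa> where "\<kappa> = (b - c) * c / (4 * v\<^sup>2)"
  define y where "y = (\<lambda>T j. if j \<in> T then c else x j)"
  have yU: "y T \<in> U" if "T \<subseteq> S" for T
    by (rule U_mono[OF x])
      (use that S c U_D(1)[OF x] in \<open>auto simp: y_def topspace_Euclidean_space subset_iff\<close>)
  have "finite S" using S(1) finite_subset by blast
  have "T \<subseteq> S \<Longrightarrow> real (card T) * \<kappa> \<le> \<Phi> x - \<Phi> (y T)" if "finite T" for T
    using that
  proof (induction T)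
    case empty
    then show ?case by (simp add: y_def)
  next
    case (insert i T)
    then have iT: "T \<subseteq> S" "i \<in> S - T" "i < n" using S by auto
    have b: "(y T)(i := b) = y T" and c': "(y T)(i := c) = y (insert i T)"
      using iT S by (auto simp: y_def)
    have yT: "y T = (\<lambda>j. if j \<in> T then c else x j)" by (simp add: y_def)
    have "\<kappa> \<le> \<Phi> ((y T)(i := b)) - \<Phi> ((y T)(i := c))"
      unfolding \<kappa>_def
      by (rule coord_increment[OF \<open>i < n\<close>])
        (use c yU[OF iT(1)] rise[OF iT(1,2) yT] in \<open>simp_all add: b\<close>)
    then show ?case using insert.IH[OF iT(1)] insert.hyps
      unfolding b c' by (simp add: distrib_right)
  qed
  then show ?thesis using \<open>finite S\<close> by (simp add: y_def \<kappa>_def)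
qed

text \<open>
  The floor \<open>b\<close> is tied to the slack homogeneously, so that multiplying the floor by a factor and the
  slack by its \<open>p\<close>-th power preserves the relation. The factor \<open>4\<^sup>p\<close> leaves room in the ball for
  doubling all coordinates that lie at the floor.
\<close>

definition floor_config :: "nat \<Rightarrow> (nat \<Rightarrow> real) \<Rightarrow> real \<Rightarrow> nat set \<Rightarrow> bool" where
  "floor_config k x b J \<longleftrightarrow> x \<in> U \<and> 0 < b \<and> J \<subseteq> {..<n} \<and> card J \<le> k \<and>
     (\<forall>i<n. b \<le> x i) \<and> (\<forall>i\<in>{..<n} - J. x i = b) \<and>
     real n * b powr p * 4 powr p = 1 - pmass p n x"

definition floor_set :: "nat \<Rightarrow> (nat \<Rightarrow> real) set" where
  "floor_set k = {x. \<exists>b J. floor_config k x b J}"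

lemma floor_set_Suc: "floor_set k \<subseteq> floor_set (Suc k)"
  unfolding floor_set_def floor_config_def by (blast intro: le_SucI)

lemma Phi_zero_le: "x \<in> U \<Longrightarrow> \<Phi> (\<lambda>_. 0) \<le> \<Phi> x"
  by (rule Phi_mono) (auto simp: topspace_Euclidean_space)

text \<open>
  The point with all coordinates equal is so close to the origin that its double still lies in the
  ball; hence the slope estimate compares it with the origin.
\<close>

lemma floor_set_0_low_point: "\<exists>x\<in>floor_set 0. \<Phi> x \<le> \<Phi> (\<lambda>_. 0) + \<nu>"
proof -
  have n: "0 < real n" using n_ge_2 by simp
  define a where "a = 1 / (real n * (1 + 4 powr p))"
  define b where "b = a powr (1 / p)"
  have "0 < a" using n unfolding a_def by (intro divide_pos_pos mult_pos_pos add_pos_nonneg) auto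
  then have b: "0 < b" "b powr p = a" using p_pos by (auto simp: b_def powr_powr)
  have na: "real n * a = 1 / (1 + 4 powr p)" using n by (simp add: a_def)
  have pos: "0 < 1 + (4::real) powr p" by (simp add: add_pos_nonneg)
  define x where "x = (\<lambda>i. if i < n then b else 0)"
  have E: "x \<in> topspace (Euclidean_space n)" by (simp add: x_def topspace_Euclidean_space)
  have pm: "pmass p n x = 1 / (1 + 4 powr p)" using b by (simp add: pmass_def x_def na)
  have "1 < (2::real) powr p" using p_pos by simp
  moreover have "(4::real) powr p = 2 powr p * 2 powr p" by (simp add: powr_mult[symmetric])
  ultimately have "(2::real) powr p \<le> 4 powr p" using mult_left_mono[of 1 "2 powr p" "2 powr p"] by simp
  then have two: "2 powr p * (1 / (1 + 4 powr p)) < 1" using pos by (simp add: field_simps)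
  have xU: "x \<in> U" using E pos by (simp add: open_lp_ball_def pm field_simps)
  have x2U: "(\<lambda>i. x i + x i) \<in> U"
    using E pmass_scale[of p n 2 x] two
    by (simp add: open_lp_ball_def pm topspace_Euclidean_space flip: mult_2)
  have "\<Phi> x - \<Phi> (\<lambda>i. x i - 1 * x i) \<le> 1 * \<nu>"
    by (rule Phi_drop_le[OF xU x2U _ E]) (use zero_in_U in auto)
  then have "\<Phi> x \<le> \<Phi> (\<lambda>_. 0) + \<nu>" by simp
  moreover have "x \<in> floor_set 0"
  proof -
    have "real n * b powr p * 4 powr p = 1 - pmass p n x"
      unfolding b na pm using pos by (simp add: field_simps)
    then show ?thesis using xU b unfolding floor_set_def floor_config_def
      by (intro CollectI exI[of _ b] exI[of _ "{}"]) (auto simp: x_def)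
  qed
  ultimately show ?thesis by blast
qed

text \<open>
  The infima of \<open>\<Phi>\<close> over the sets \<open>floor_set k\<close> decrease with \<open>k\<close>, by at most \<open>\<nu>\<close> altogether. So among the
  first \<open>n/2\<close> steps one decreases by at most a constant multiple of \<open>\<nu>/n\<close>, which is below 1/8. A point
  of value within 1/8 of the infimum for that \<open>k\<close> is enough.
\<close>

lemma almost_minimizer:
  assumes "\<nu> < real n / 24"
  shows "\<exists>k < n div 2. \<exists>x\<in>floor_set k. \<forall>y\<in>floor_set (Suc k). \<Phi> x - 1/4 \<le> \<Phi> y"
proof -
  define m where "m = n div 2"
  define G where "G = (\<lambda>k. Inf (\<Phi> ` floor_set k))"
  have FU: "floor_set k \<subseteq> U" for k by (auto simp: floor_set_def floor_config_def)
  have bdd: "bdd_below (\<Phi> ` floor_set k)" for k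
    using FU Phi_zero_le by (intro bdd_belowI[of _ "\<Phi> (\<lambda>_. 0)"]) blast
  obtain x0 where x0: "x0 \<in> floor_set 0" "\<Phi> x0 \<le> \<Phi> (\<lambda>_. 0) + \<nu>" using floor_set_0_low_point by blast
  have "x0 \<in> floor_set k" for k by (induction k) (use x0 floor_set_Suc in auto)
  then have ne: "\<Phi> ` floor_set k \<noteq> {}" for k by blast
  have "G 0 \<le> \<Phi> x0" unfolding G_def using x0 bdd by (intro cInf_lower) auto
  moreover have "\<Phi> (\<lambda>_. 0) \<le> G m" unfolding G_def
    using FU Phi_zero_le by (intro cInf_greatest ne) blast
  ultimately have total: "G 0 - G m \<le> \<nu>" using x0 by simp
  have "0 < m" using n_ge_2 by (simp add: m_def)
  have "\<exists>k<m. G k - G (Suc k) \<le> 1/8"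
  proof (rule ccontr)
    assume "\<not> ?thesis"
    then have "(\<Sum>k<m. 1/8) \<le> (\<Sum>k<m. G k - G (Suc k))" by (intro sum_mono) auto
    also have "\<dots> = G 0 - G m" by (rule sum_lessThan_telescope')
    finally have "real m / 8 \<le> \<nu>" using total by simp
    moreover have "n \<le> 3 * m" using n_ge_2 unfolding m_def by linarith
    then have "real n \<le> 3 * real m" by linarith
    ultimately show False using assms by simp
  qed
  then obtain k where k: "k < m" "G k - G (Suc k) \<le> 1/8" by blast
  obtain x where x: "x \<in> floor_set k" "\<Phi> x < G k + 1/8"
    using cInf_lessD[OF ne, of k "G k + 1/8"] by (auto simp: G_def)
  have "\<Phi> x - 1/4 \<le> \<Phi> y" if "y \<in> floor_set (Suc k)" for y
  proof -
    have "G (Suc k) \<le> \<Phi> y" unfolding G_def using that bdd by (intro cInf_lower) auto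
    then show ?thesis using x k by simp
  qed
  then show ?thesis using k x unfolding m_def by blast
qed

section \<open>Lowering the coordinates at the floor\<close>

context
  fixes x :: "nat \<Rightarrow> real" and b :: real and J :: "nat set" and k :: nat
  assumes config: "floor_config k x b J" and k_small: "k < n div 2"
begin

lemma x_in_U: "x \<in> U" and b_pos: "0 < b" and J_small: "J \<subseteq> {..<n}" "card J \<le> k"
  and ge_b: "i < n \<Longrightarrow> b \<le> x i" and eq_b: "i < n \<Longrightarrow> i \<notin> J \<Longrightarrow> x i = b"
  and slack: "real n * b powr p * 4 powr p = 1 - pmass p n x"
  using config by (auto simp: floor_config_def)

abbreviation "S \<equiv> {..<n} - J"
abbreviation "low c \<equiv> (\<lambda>i. if i \<in> S then c else x i)"

lemma x_space: "x \<in> topspace (Euclidean_space n)"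
  by (rule U_D(1)[OF x_in_U])

lemma card_S: "real n / 2 \<le> real (card S)" "card S \<le> n"
proof -
  have "card S = n - card J" using J_small finite_subset[OF J_small(1)] by (simp add: card_Diff_subset)
  then show "real n / 2 \<le> real (card S)" "card S \<le> n" using J_small k_small by linarith+
qed

lemma pmass_low:
  assumes "0 \<le> c"
  shows "pmass p n (low c) = pmass p n x - real (card S) * (b powr p - c powr p)"
  using pmass_constant_change[of S n x b p c] eq_b assms b_pos by simp

lemma low_in_U:
  assumes "0 \<le> c" "c \<le> b"
  shows "low c \<in> U"
  by (rule U_mono[OF x_in_U])
    (use assms eq_b x_space in \<open>auto simp: topspace_Euclidean_space\<close>)

lemma slack_pos: "0 < 1 - pmass p n x"
  using U_D(2)[OF x_in_U] by simp

lemma card_S_mass: "real (card S) * b powr p * 4 powr p \<le> 1 - pmass p n x"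
proof -
  have "real (card S) * (b powr p * 4 powr p) \<le> real n * (b powr p * 4 powr p)"
    using card_S by (intro mult_right_mono) auto
  then show ?thesis using slack by (simp add: mult.assoc)
qed

text \<open>
  Raising a floor coordinate to \<open>r\<close> with \<open>r\<^sup>p = 2 \<delta>\<close> leaves the ball, whatever other floor coordinates
  are lowered, because these carry mass at most \<open>\<delta>\<close>. So the curvature along the axes is at least
  \<open>1/(4r\<^sup>2)\<close>, and halving all of at least \<open>n/2\<close> floor coordinates costs at least a constant times
  \<open>n (b/r)\<^sup>2\<close>, which is of the order of \<open>n\<^bsup>1-2/p\<^esup>\<close>.
\<close>

lemma half_drop_small_imp:
  assumes "\<Phi> x - \<Phi> (low (b / 2)) < 2"
  shows "real n \<le> 4096 powr (p / (p - 2))"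
proof -
  define \<delta> where "\<delta> = 1 - pmass p n x"
  have \<delta>: "0 < \<delta>" using slack_pos by (simp add: \<delta>_def)
  have n: "0 < real n" using n_ge_2 by simp
  define r where "r = (2 * \<delta>) powr (1 / p)"
  have r: "0 < r" "r powr p = 2 * \<delta>" using \<delta> p_pos by (simp_all add: r_def powr_powr)
  have four: "1 \<le> (4::real) powr p" using p_pos by (simp add: ge_one_powr_ge_zero)
  have mass_le: "real (card S) * b powr p \<le> \<delta>"
  proof -
    have "real (card S) * b powr p * 1 \<le> real (card S) * b powr p * 4 powr p"
      using four by (intro mult_left_mono) auto
    then show ?thesis using card_S_mass by (simp add: \<delta>_def)
  qed
  have r_eq: "r powr p = 2 * (real n * b powr p * 4 powr p)" using r slack by (simp add: \<delta>_def)
  have "b \<le> r"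
  proof (rule ccontr)
    assume "\<not> b \<le> r"
    then have "r powr p < b powr p" using r p_pos by (intro powr_less_mono2) auto
    moreover have "1 * b powr p * 1 \<le> 2 * real n * b powr p * 4 powr p"
      using four n_ge_2 by (intro mult_mono) auto
    ultimately show False using r_eq by simp
  qed
  have "real (card S) * ((b - b / 2) * (b / 2) / (4 * r\<^sup>2)) \<le> \<Phi> x - \<Phi> (low (b / 2))"
  proof (rule lowering_drop[OF x_in_U])
    fix T i and z :: "nat \<Rightarrow> real"
    assume T: "T \<subseteq> S" "i \<in> S - T" and z: "z = (\<lambda>j. if j \<in> T then b / 2 else x j)"
    assume zU: "z(i := r) \<in> U"
    have "i < n" using T by auto
    have "pmass p n (low 0) \<le> pmass p n (z(i := 0))"
      by (rule pmass_mono[OF p_pos]) (use T b_pos ge_b in \<open>auto simp: z\<close>)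
    then have "1 - 2 * \<delta> \<le> pmass p n (z(i := 0))"
      using pmass_low[of 0] mass_le p_pos by (simp add: \<delta>_def)
    then have "1 \<le> pmass p n (z(i := r))"
      unfolding pmass_upd[OF \<open>i < n\<close>, of p z r] using r by simp
    then show "\<Phi> (z(i := r)) \<ge> \<Phi> (z(i := 0)) + 1" using U_D(2)[OF zU] by simp
  qed (use b_pos \<open>b \<le> r\<close> r eq_b in auto)
  with assms have "real (card S) * (b\<^sup>2 / (16 * r\<^sup>2)) < 2"
    by (simp add: power2_eq_square)
  moreover have "real n / 2 * (b\<^sup>2 / (16 * r\<^sup>2)) \<le> real (card S) * (b\<^sup>2 / (16 * r\<^sup>2))"
    using card_S by (intro mult_right_mono) auto
  ultimately have "real n / 2 * (b\<^sup>2 / (16 * r\<^sup>2)) < 2" by linarith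
  then have main: "real n * b\<^sup>2 < 64 * r\<^sup>2" using r by (simp add: field_simps)
  have "r \<le> 8 * b * real n powr (1 / p)"
  proof -
    have "r powr p \<le> (8 * b * real n powr (1 / p)) powr p"
    proof -
      have "2 * (4::real) powr p \<le> 2 powr p * 4 powr p"
        using one_plus_le_two_powr[of p] p_gt_2 by (intro mult_right_mono) auto
      also have "\<dots> = 8 powr p" by (simp add: powr_mult[symmetric])
      finally have "(2 * 4 powr p) * (real n * b powr p) \<le> 8 powr p * (real n * b powr p)"
        by (intro mult_right_mono) auto
      moreover have "(8 * b * real n powr (1 / p)) powr p = 8 powr p * b powr p * real n"
        using b_pos n p_pos by (simp add: powr_mult powr_powr)
      ultimately show ?thesis unfolding r_eq by (simp add: mult_ac)
    qed
    then show ?thesis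
      using powr_less_mono2[of p "8 * b * real n powr (1 / p)" r] b_pos n p_pos
      by (meson leI leD less_imp_le mult_nonneg_nonneg powr_ge_zero zero_le_numeral)
  qed
  then have "r\<^sup>2 \<le> (8 * b * real n powr (1 / p))\<^sup>2" using r by (intro power_mono) auto
  also have "\<dots> = 64 * b\<^sup>2 * real n powr (2 / p)"
    using n by (simp add: power_mult_distrib power2_eq_square powr_add[symmetric])
  finally have "real n * b\<^sup>2 \<le> 64 * (64 * b\<^sup>2 * real n powr (2 / p))" using main by linarith
  then have "real n * b\<^sup>2 \<le> (4096 * real n powr (2 / p)) * b\<^sup>2" by (simp add: mult_ac)
  then have "real n \<le> 4096 * real n powr (2 / p)" using b_pos by simp
  then show ?thesis using n p_gt_2 by (intro powr_self_bound) auto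
qed

lemma obtain_unit_drop:
  assumes "2 \<le> \<Phi> x - \<Phi> (low (b / 2))"
  obtains \<eta> where "0 < \<eta>" "\<eta> \<le> 1/2" "\<Phi> x - \<Phi> (low ((1 - \<eta>) * b)) = 2"
proof -
  define h where "h = (\<lambda>i. if i \<in> S then - b else 0)"
  have h: "h \<in> topspace (Euclidean_space n)" by (auto simp: h_def topspace_Euclidean_space)
  have eq: "(\<lambda>i. x i + t * h i) = low ((1 - t) * b)" for t
    using eq_b by (auto simp: h_def algebra_simps)
  define g where "g = (\<lambda>t. \<Phi> (\<lambda>i. x i + t * h i))"
  have "isCont g t" if "0 \<le> t" "t \<le> 1/2" for t
  proof -
    have "(1 - t) * b \<le> 1 * b" using that b_pos by (intro mult_right_mono) auto
    then have "(\<lambda>i. x i + t * h i) \<in> U"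
      unfolding eq using that b_pos by (intro low_in_U) auto
    then show ?thesis unfolding g_def by (rule DERIV_isCont[OF line_has_derivative(1)[OF _ h]])
  qed
  moreover have "g 0 = \<Phi> x" by (simp add: g_def)
  moreover have "g (1/2) = \<Phi> (low (b / 2))" 
  proof -
    have "(1 - 1/2) * b = b / 2" by simp
    then show ?thesis unfolding g_def eq by presburger
  qed
  ultimately obtain t where t: "0 \<le> t" "t \<le> 1/2" "g t = \<Phi> x - 2"
    using IVT2[of g "1/2" "\<Phi> x - 2" 0] assms by auto
  have "t \<noteq> 0" using t \<open>g 0 = \<Phi> x\<close> by auto
  then show ?thesis using that[of t] t unfolding g_def eq by simp
qed

text \<open>
  The core of the argument: near minimality of \<open>x\<close> turns a drop by 2, caused by lowering all floor
  coordinates a little, into a rise of \<open>\<Phi>\<close> when a single one of them is raised.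
\<close>

lemma unit_drop_bound:
  assumes min: "\<And>y. y \<in> floor_set (Suc k) \<Longrightarrow> \<Phi> x - 1/4 \<le> \<Phi> y"
    and \<eta>: "0 < \<eta>" "\<eta> \<le> 1/2" and drop: "\<Phi> x - \<Phi> (low ((1 - \<eta>) * b)) = 2"
  shows "\<eta> * real n \<le> 32768 powr (p / (p - 2))"
proof -
  define c where "c = (1 - \<eta>) * b"
  have drop': "\<Phi> x - \<Phi> (low c) = 2" unfolding c_def by (rule drop)
  define q where "q = (1 - \<eta>) powr p"
  define \<delta> where "\<delta> = 1 - pmass p n x"
  define B where "B = b powr p"
  define N where "N = real (card S)"
  have \<delta>: "0 < \<delta>" using slack_pos by (simp add: \<delta>_def)
  have n: "0 < real n" using n_ge_2 by simp
  have B: "0 < B" using b_pos by (simp add: B_def)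
  have N: "real n / 2 \<le> N" "N \<ge> 1" "N \<le> real n" using card_S n_ge_2 by (auto simp: N_def)
  have "c \<le> 1 * b" unfolding c_def using \<eta> b_pos by (intro mult_right_mono) auto
  then have c: "0 < c" "c \<le> b" using \<eta> b_pos by (auto simp: c_def)
  have cp: "c powr p = q * B" using \<eta> b_pos by (simp add: c_def q_def B_def powr_mult)
  have q: "0 < q" "q \<le> 1" using \<eta> p_pos by (auto simp: q_def powr_le1)
  have \<delta>_eq: "\<delta> = real n * B * 4 powr p" using slack by (simp add: \<delta>_def B_def)
  \<comment> \<open>Raising one floor coordinate to \<open>A\<^bsup>1/p\<^esup>\<close> and lowering the others to \<open>c\<close> gives slack \<open>q \<delta>\<close>.\<close>
  define A where "A = B + (1 - q) * (\<delta> + (N - 1) * B)"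
  have A: "B \<le> A" using q \<delta> N B by (simp add: A_def)
  define v where "v = A powr (1 / p)"
  have v: "0 < v" "v powr p = A" using A B p_pos by (simp_all add: v_def powr_powr)
  have "b \<le> v"
  proof (rule ccontr)
    assume "\<not> b \<le> v"
    then have "v powr p < b powr p" using v p_pos by (intro powr_less_mono2) auto
    then show False using A v by (simp add: B_def)
  qed
  \<comment> \<open>The test point has floor \<open>c\<close>, and \<open>i\<close> joins the exceptional coordinates.\<close>
  have test: "(low c)(i := v) \<in> floor_set (Suc k)" if i: "i \<in> S" for i
  proof -
    have "i < n" using i by simp
    have "pmass p n ((low c)(i := c)) = pmass p n (low c)" using i by (simp add: fun_upd_idem)
    then have "pmass p n ((low c)(i := v)) = pmass p n (low c) - c powr p + v powr p"
      using pmass_upd[OF \<open>i < n\<close>, of p "low c" c] pmass_upd[OF \<open>i < n\<close>, of p "low c" v] c v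
      by linarith
    also have "\<dots> = 1 - \<delta> - N * (B - q * B) - q * B + A"
      using pmass_low[of c] c v by (simp add: cp N_def B_def \<delta>_def)
    also have "\<dots> = 1 - q * \<delta>" by (simp add: A_def algebra_simps)
    finally have pm: "pmass p n ((low c)(i := v)) = 1 - q * \<delta>" .
    have E: "(low c)(i := v) \<in> topspace (Euclidean_space n)"
      using x_space \<open>i < n\<close> by (auto simp: topspace_Euclidean_space)
    have "(low c)(i := v) \<in> U" using E pm q \<delta> by (simp add: open_lp_ball_def)
    moreover have "card (insert i J) \<le> Suc k" using J_small by (metis card_insert_le_m1 card_insert_if
          finite_lessThan finite_subset le_SucI not_less_eq_eq)
    moreover have "c \<le> ((low c)(i := v)) j" if "j < n" for j
      using ge_b[OF that] c \<open>b \<le> v\<close> by auto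
    moreover have "real n * c powr p * 4 powr p = 1 - pmass p n ((low c)(i := v))"
      unfolding pm cp by (simp add: \<delta>_eq)
    ultimately show ?thesis unfolding floor_set_def floor_config_def
      using c J_small(1) \<open>i < n\<close> by (intro CollectI exI[of _ c] exI[of _ "insert i J"]) auto
  qed
  have "N * ((b - c) * c / (4 * (2 * v)\<^sup>2)) \<le> \<Phi> x - \<Phi> (low c)"
    unfolding N_def
  proof (rule lowering_drop[OF x_in_U])
    fix T i and z :: "nat \<Rightarrow> real"
    assume T: "T \<subseteq> S" "i \<in> S - T" and z: "z = (\<lambda>j. if j \<in> T then c else x j)"
    assume zU: "z(i := 2 * v) \<in> U"
    have i: "i < n" "i \<in> S" using T by auto
    \<comment> \<open>\<open>w\<close> is the reflection of \<open>z(i := 2 * v)\<close> in the test point;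
      \<open>\<eta> \<le> 1/2\<close> keeps \<open>2 * c - b\<close> nonnegative.\<close>
    define w where "w = (\<lambda>j. if j = i then 0 else if j \<in> T then c else if j \<in> S then 2 * c - b else x j)"
    have wE: "w \<in> topspace (Euclidean_space n)"
      using x_space T i by (auto simp: w_def topspace_Euclidean_space)
    have "c \<ge> b / 2" using \<eta> b_pos by (simp add: c_def)
    then have w_le: "\<bar>w j\<bar> \<le> \<bar>(low c) j\<bar>" for j using c T by (auto simp: w_def)
    have lowU: "low c \<in> U" using c by (intro low_in_U) auto
    have "w \<in> U" by (rule U_mono[OF lowU wE w_le])
    have "\<Phi> w \<le> \<Phi> (low c)" by (rule Phi_mono[OF lowU wE w_le])
    then have w: "\<Phi> w \<le> \<Phi> x - 2" using drop' by linarith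
    have mid: "(\<lambda>j. 1/2 * (z(i := 2 * v)) j + 1/2 * w j) = (low c)(i := v)"
    proof
      fix j
      have "j \<in> T \<Longrightarrow> j \<in> S" using T by blast
      then show "1/2 * (z(i := 2 * v)) j + 1/2 * w j = ((low c)(i := v)) j"
        using i eq_b[of j]
        by (cases "j = i"; cases "j \<in> T"; cases "j \<in> S") (auto simp: w_def z field_simps)
    qed
    have "\<Phi> ((low c)(i := v)) \<le> 1/2 * \<Phi> (z(i := 2 * v)) + 1/2 * \<Phi> w"
      using Phi_convex(2)[OF zU \<open>w \<in> U\<close>, of "1/2" "1/2"] unfolding mid by simp
    then have "\<Phi> (z(i := 2 * v)) \<ge> \<Phi> x + 1" using min[OF test[OF i(2)]] w by linarith
    moreover have "\<Phi> (z(i := 0)) \<le> \<Phi> x"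
      by (rule Phi_mono[OF x_in_U])
        (use x_space i T c eq_b in \<open>auto simp: z topspace_Euclidean_space\<close>)
    ultimately show "\<Phi> (z(i := 2 * v)) \<ge> \<Phi> (z(i := 0)) + 1" by linarith
  qed (use c b_pos v \<open>b \<le> v\<close> eq_b in auto)
  then have "N * ((b - c) * c / (16 * v\<^sup>2)) \<le> 2"
    unfolding drop' by (simp add: power_mult_distrib)
  moreover have "real n / 2 * (\<eta> * b * (b / 2) / (16 * v\<^sup>2)) \<le> N * ((b - c) * c / (16 * v\<^sup>2))"
  proof (intro mult_mono divide_right_mono)
    have "\<eta> * b \<le> 1/2 * b" using \<eta> b_pos by (intro mult_right_mono) auto
    then show "\<eta> * b \<le> b - c" "b / 2 \<le> c" by (auto simp: c_def algebra_simps)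
  qed (use N \<eta> b_pos c in auto)
  ultimately have "real n / 2 * (\<eta> * b * (b / 2) / (16 * v\<^sup>2)) \<le> 2" by linarith
  then have main: "(\<eta> * real n) * b\<^sup>2 \<le> 128 * v\<^sup>2"
    using v by (simp add: field_simps power2_eq_square)
  define X where "X = \<eta> * real n"
  have X: "0 < X" using \<eta> n by (simp add: X_def)
  show ?thesis
  proof (cases "X \<le> 1")
    case True
    also have "(1::real) \<le> 32768 powr (p / (p - 2))"
      using p_gt_2 by (intro ge_one_powr_ge_zero) auto
    finally show ?thesis by (simp add: X_def)
  next
    case False
    have "v \<le> 16 * b * X powr (1 / p)"
    proof -
      have "(N - 1) * B \<le> \<delta>"
      proof -
        have "(N - 1) * B * 1 \<le> real n * B * 4 powr p"
          using N B p_pos by (intro mult_mono) (auto simp: ge_one_powr_ge_zero)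
        then show ?thesis by (simp add: \<delta>_eq)
      qed
      then have "(1 - q) * (\<delta> + (N - 1) * B) \<le> (2 * p * \<eta>) * (2 * \<delta>)"
        using one_minus_powr_le[of \<eta> p] \<eta> p_pos q \<delta> B N by (intro mult_mono) (auto simp: q_def)
      also have "\<dots> = B * (4 * p * 4 powr p) * X" by (simp add: \<delta>_eq X_def)
      finally have "A \<le> B * 1 * 1 + B * (4 * p * 4 powr p) * X" by (simp add: A_def)
      also have "\<dots> \<le> B * 4 powr p * X + B * (4 * p * 4 powr p) * X"
        using False B p_pos by (intro add_right_mono mult_mono) (auto simp: ge_one_powr_ge_zero)
      also have "\<dots> = B * X * ((1 + 4 * p) * 4 powr p)" by (simp add: algebra_simps)
      also have "\<dots> \<le> B * X * (4 powr p * 4 powr p)"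
      proof -
        have two: "1 + p \<le> 2 powr p" using p_gt_2 by (intro one_plus_le_two_powr) auto
        have "(2::real) powr 2 \<le> 2 powr p" using p_gt_2 by (intro powr_mono) auto
        then have four: "4 \<le> (2::real) powr p" by simp
        have "1 + 4 * p \<le> 4 * (1 + p)" by simp
        also have "\<dots> \<le> 2 powr p * 2 powr p" using two four p_pos by (intro mult_mono) auto
        also have "\<dots> = 4 powr p" by (simp add: powr_mult[symmetric])
        finally show ?thesis using B X by (intro mult_left_mono mult_right_mono) auto
      qed
      also have "\<dots> = (16 * b * X powr (1 / p)) powr p"
      proof -
        have "(4::real) powr p * 4 powr p = 16 powr p" by (simp add: powr_mult[symmetric])
        then show ?thesis using b_pos X p_pos by (simp add: powr_mult powr_powr B_def)
      qed
      finally have "v powr p \<le> (16 * b * X powr (1 / p)) powr p" using v by simp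
      then show ?thesis
        using powr_less_mono2[of p "16 * b * X powr (1 / p)" v] b_pos X p_pos
        by (meson leI leD less_imp_le mult_nonneg_nonneg powr_ge_zero zero_le_numeral)
    qed
    then have "v\<^sup>2 \<le> (16 * b * X powr (1 / p))\<^sup>2" using v by (intro power_mono) auto
    also have "\<dots> = 256 * b\<^sup>2 * X powr (2 / p)"
      using X by (simp add: power_mult_distrib power2_eq_square powr_add[symmetric])
    finally have "X * b\<^sup>2 \<le> 128 * (256 * b\<^sup>2 * X powr (2 / p))" using main unfolding X_def by linarith
    then have "X * b\<^sup>2 \<le> (32768 * X powr (2 / p)) * b\<^sup>2" by (simp add: mult_ac)
    then have "X \<le> 32768 * X powr (2 / p)" using b_pos by simp
    then show ?thesis using X p_gt_2 unfolding X_def[symmetric] by (intro powr_self_bound) auto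
  qed
qed

text \<open>
  All floor coordinates can be doubled inside the ball, so the slope in their direction is at most \<open>\<nu>\<close>.
\<close>

lemma unit_drop_nu:
  assumes \<eta>: "0 < \<eta>" "\<eta> \<le> 1/2" and drop: "\<Phi> x - \<Phi> (low ((1 - \<eta>) * b)) = 2"
  shows "2 \<le> \<eta> * \<nu>"
proof -
  define h where "h = (\<lambda>i. if i \<in> S then b else 0)"
  have h: "h \<in> topspace (Euclidean_space n)" by (auto simp: h_def topspace_Euclidean_space)
  have plus: "(\<lambda>i. x i + h i) = low (2 * b)" using eq_b by (auto simp: h_def)
  have minus: "(\<lambda>i. x i - \<eta> * h i) = low ((1 - \<eta>) * b)"
    using eq_b by (auto simp: h_def algebra_simps)
  have "low (2 * b) \<in> U"
  proof -
    have E: "low (2 * b) \<in> topspace (Euclidean_space n)"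
      using x_space by (auto simp: topspace_Euclidean_space)
    define M where "M = real (card S) * b powr p"
    have "pmass p n (low (2 * b)) = pmass p n x + M * (2 powr p - 1)"
      using b_pos pmass_low[of "2 * b"] by (simp add: powr_mult M_def algebra_simps)
    also have "\<dots> < 1"
    proof -
      have "M > 0" using card_S n_ge_2 b_pos by (auto simp: M_def)
      have "M * 4 powr p \<le> 1 - pmass p n x" using card_S_mass by (simp add: M_def)
      moreover have "(2::real) powr p \<le> 4 powr p" using p_pos by (intro powr_mono2) auto
      then have "M * (2 powr p - 1) < M * 4 powr p"
        using \<open>M > 0\<close> by (intro mult_strict_left_mono) auto
      ultimately show ?thesis by linarith
    qed
    finally show ?thesis using E by (simp add: open_lp_ball_def)
  qed
  then have plusU: "(\<lambda>i. x i + h i) \<in> U" unfolding plus .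
  have "(1 - \<eta>) * b \<le> 1 * b" using \<eta> b_pos by (intro mult_right_mono) auto
  then have "low ((1 - \<eta>) * b) \<in> U" using \<eta> b_pos by (intro low_in_U) auto
  then have minusU: "(\<lambda>i. x i - \<eta> * h i) \<in> U" unfolding minus .
  have "\<Phi> x - \<Phi> (\<lambda>i. x i - \<eta> * h i) \<le> \<eta> * \<nu>"
    by (rule Phi_drop_le[OF x_in_U plusU minusU h]) (use \<eta> in simp)
  then show ?thesis unfolding minus using drop by simp
qed

end

theorem nu_lower_bound: "\<nu> \<ge> real n / 262144 powr (p / (p - 2))"
proof -
  define e where "e = p / (p - 2)"
  have e: "1 \<le> e" using p_gt_2 by (simp add: e_def)
  have n: "0 < real n" using n_ge_2 by simp
  have base: "a \<le> a powr e" if "1 \<le> a" for a :: real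
    using powr_mono[of 1 e a] e that by simp
  have "real n \<le> \<nu> * 262144 powr e"
  proof (cases "\<nu> < real n / 24")
    case False
    have "real n \<le> \<nu> * 24" using False by simp
    also have "\<dots> \<le> \<nu> * 262144 powr e" using base[of 262144] nu_pos by (intro mult_left_mono) auto
    finally show ?thesis .
  next
    case True
    obtain k x where k: "k < n div 2" and xF: "x \<in> floor_set k"
      and min: "\<And>y. y \<in> floor_set (Suc k) \<Longrightarrow> \<Phi> x - 1/4 \<le> \<Phi> y"
      using almost_minimizer[OF True] by blast
    obtain b J where "floor_config k x b J"
      using xF unfolding floor_set_def by blast
    note ctx = this k
    show ?thesis
    proof (cases "\<Phi> x - \<Phi> (\<lambda>i. if i \<in> {..<n} - J then b / 2 else x i) < 2")
      case True
      have "1 * real n \<le> (\<nu> * 64) * 4096 powr e"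
        using half_drop_small_imp[OF ctx True] nu_ge unfolding e_def by (intro mult_mono) auto
      also have "\<dots> \<le> (\<nu> * 64 powr e) * 4096 powr e"
        using base[of 64] nu_pos by (intro mult_mono) auto
      also have "\<dots> = \<nu> * 262144 powr e" by (simp add: powr_mult[symmetric] mult.assoc)
      finally show ?thesis by simp
    next
      case False
      then have "2 \<le> \<Phi> x - \<Phi> (\<lambda>i. if i \<in> {..<n} - J then b / 2 else x i)"
        by linarith
      then obtain \<eta> where \<eta>: "0 < \<eta>" "\<eta> \<le> 1/2"
        "\<Phi> x - \<Phi> (\<lambda>i. if i \<in> {..<n} - J then (1 - \<eta>) * b else x i) = 2"
        by (rule obtain_unit_drop[OF ctx])
      have "real n * \<eta> \<le> 32768 powr e"
        using unit_drop_bound[OF ctx min \<eta>] by (simp add: e_def mult.commute)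
      also have "\<dots> \<le> 262144 powr e" using e by (intro powr_mono2) auto
      also have "\<dots> \<le> (\<eta> * \<nu>) * 262144 powr e"
        using mult_right_mono[of 1 "\<eta> * \<nu>" "262144 powr e"] unit_drop_nu[OF ctx \<eta>] by simp
      finally show ?thesis using \<eta>(1) by (simp add: mult_ac)
    qed
  qed
  then show ?thesis unfolding e_def by (simp add: field_simps)
qed

end

theorem theorem3:
  "\<exists>C>0. \<forall>p>2. \<forall>n\<ge>2. \<forall>(\<nu>::real) (\<Phi> :: (nat \<Rightarrow> real) \<Rightarrow> real).
     barrier n (lp_ball p n) \<Phi> \<longrightarrow>
     nu_self_concordant \<nu> n (lp_ball p n) \<Phi> \<longrightarrow>
     (\<forall>x \<in> interior_Rn n (lp_ball p n). \<Phi> x = \<Phi> (\<lambda>i. \<bar>x i\<bar>)) \<longrightarrow>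
     \<nu> \<ge> real n / (C * p * ln (real n)) powr (p / (p - 2))"
proof (intro exI[of _ 262144] conjI allI impI)
  fix p :: real and n :: nat and \<nu> :: real and \<Phi> :: "(nat \<Rightarrow> real) \<Rightarrow> real"
  assume p: "2 < p" and n: "2 \<le> n" and "barrier n (lp_ball p n) \<Phi>"
    and "nu_self_concordant \<nu> n (lp_ball p n) \<Phi>"
    and "\<forall>x \<in> interior_Rn n (lp_ball p n). \<Phi> x = \<Phi> (\<lambda>i. \<bar>x i\<bar>)"
  then interpret symmetric_lp_barrier p \<nu> n \<Phi>
    by unfold_locales auto
  have "1/2 \<le> ln (real n)"
  proof -
    have "ln 2 \<le> ln (real n)" using n by simp
    then show ?thesis using ln2_ge_two_thirds by linarith
  qed
  then have "2 * (1/2) \<le> p * ln (real n)" using p by (intro mult_mono) auto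
  then have "262144 powr (p / (p - 2)) \<le> (262144 * p * ln (real n)) powr (p / (p - 2))"
    using p by (intro powr_mono2) auto
  then have "real n / (262144 * p * ln (real n)) powr (p / (p - 2)) \<le> real n / 262144 powr (p / (p - 2))"
    by (intro divide_left_mono mult_pos_pos) (auto simp: p)
  also have "\<dots> \<le> \<nu>" by (rule nu_lower_bound)
  finally show "real n / (262144 * p * ln (real n)) powr (p / (p - 2)) \<le> \<nu>" .
qed simp

end
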